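(* Let $\mathbf h_n^\alpha$ be the exact coefficients of the one-dimensional second-order accurate fractional central difference stencil, and let $\widetilde{\mathbf h}_n^\alpha$ be the coefficients of this stencil with $2N+1$ terms ($n=-N,\dots,N$) evaluated through the fast Fourier transform (FFT). Then the error of the stencil is $$\mathbf h_n^\alpha-\widetilde{\mathbf h}_n^\alpha=-\sum_{\substack{k=-\infty\\ k\neq0}}^{\infty}\mathbf h_{n+2Nk}^\alpha=\sum_{\substack{k=-\infty\\ k\neq0}}^{\infty}(-1)^{n+1}\binom{\alpha}{\frac{\alpha}{2}+n+2Nk}>0 .$$ Consequently the error in the discrete Fourier domain at the origin is $$\mathrm{FFT}_{2N+1}\{\mathbf h^\alpha-\widetilde{\mathbf h}^\alpha\}_0=\sum_{n=-N}^{N}\left(\mathbf h_n^\alpha-\widetilde{\mathbf h}_n^\alpha\right)>2NhC=O(1),$$ where $C$ is a constant. That is, the second-order stencil evaluated with the FFT has an $O(1)$ error, so its spectrum, and thus the solution, does not converge with respect to the spatial distance $h$.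
   Context: $\alpha$ is the order of the fractional Laplacian $(-\Delta)^{\alpha/2}$, and $h$ is the spatial distance between grid nodes, with $Nh$ of order one. The exact coefficients have the closed form $\mathbf h_n^\alpha=(-1)^n\binom{\alpha}{\alpha/2+n}$, i.e. they are the Fourier coefficients $\frac1{2\pi}\int_0^{2\pi}\left(4\sin^2\frac{\omega}{2}\right)^{\alpha/2}\cos(n\omega)\,d\omega$, with the binomial coefficient defined through Gamma functions. Evaluating by FFT means replacing this integral by the trapezoidal rule at the frequencies $\omega=\frac{j\pi}{N}$, $j=0,\dots,2N-1$. $\mathrm{FFT}_{2N+1}\{\cdot\}_0$ denotes the zero-frequency component of the discrete Fourier transform of the $2N+1$ terms $n=-N,\dots,N$. To approximate the fractional Laplacian the stencil is multiplied by $h^{-\alpha}$. Because of the branch point of the spectrum at the origin, the convergence of the FFT-evaluated coefficients in one dimension is limited to order $1+\alpha$, which when multiplied by $h^{-\alpha}$ gives an error of $O(h)$ for each of the $2N+1$ coefficients about the origin; this is where the $h$ in $2NhC$ comes from.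
   Formalization: Taken for 0<α<2 (positivity fails for α≥2, N=1); the bound >2NhC is for the stencil multiplied by h^{-α} with Nh between fixed positive bounds (unscaled it fails); "solution" means that of the (2N+1)-periodic stencil equation with data of mean bounded away from 0. *)

theory Defs
  imports "HOL-Analysis.Analysis" "HOL-Library.Landau_Symbols"
begin

text \<open>
  Binomial coefficient with two real arguments. At the poles of the denominator the value is 0,
  as it should be, because \<^term>\<open>Gamma\<close> is 0 there and division by 0 yields 0.
\<close>

definition gamma_binomial :: "real \<Rightarrow> real \<Rightarrow> real" where
  "gamma_binomial x y = Gamma (x + 1) / (Gamma (y + 1) * Gamma (x - y + 1))"

definition exact_coeff :: "real \<Rightarrow> int \<Rightarrow> real" where
  "exact_coeff \<alpha> n = (-1) powi n * gamma_binomial \<alpha> (\<alpha> / 2 + of_int n)"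

definition stencil_symbol :: "real \<Rightarrow> real \<Rightarrow> real" where
  "stencil_symbol \<alpha> \<omega> = (4 * (sin (\<omega> / 2))\<^sup>2) powr (\<alpha> / 2)"

text \<open>
  The \<^term>\<open>n\<close>-th Fourier coefficient of the symbol (the integral over a period, divided by
  \<open>2 * pi\<close>), with the integral replaced by the trapezoidal rule with \<open>2 * N\<close> steps of length
  \<open>pi / N\<close>. The two end points of the period are identified, so all weights are equal to
  \<open>(pi / N) / (2 * pi)\<close>.
\<close>

definition fft_coeff :: "real \<Rightarrow> nat \<Rightarrow> int \<Rightarrow> real" where
  "fft_coeff \<alpha> N n =
     (\<Sum>j<2*N. stencil_symbol \<alpha> (real j * pi / real N) * cos (of_int n * (real j * pi / real N)))
       / (2 * real N)"

text \<open>
  The discrete Fourier transform of length \<open>2 * N + 1\<close> of the terms \<open>-N, ..., N\<close>; the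
  argument \<open>j\<close> is the frequency index, taken modulo \<open>2 * N + 1\<close>.
\<close>

definition dft :: "nat \<Rightarrow> (int \<Rightarrow> real) \<Rightarrow> int \<Rightarrow> complex" where
  "dft N s j =
     (\<Sum>n = - int N..int N. of_real (s n) * cis (- 2 * pi * of_int j * of_int n / of_int (2 * int N + 1)))"

text \<open>
  Multiplication of a stencil by \<open>h\<close> to the power \<open>-\<alpha>\<close>, which turns it into an
  approximation of the fractional Laplacian of order \<open>\<alpha>\<close>.
\<close>

definition scaled :: "real \<Rightarrow> real \<Rightarrow> (int \<Rightarrow> real) \<Rightarrow> int \<Rightarrow> real" where
  "scaled \<alpha> h s n = h powr (- \<alpha>) * s n"

text \<open>
  \<open>u\<close> is a solution of the discrete equation with right-hand side \<open>f\<close> whose operator is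
  the convolution with the terms \<open>-N, ..., N\<close> of \<open>s\<close> on grid functions of period
  \<open>2 * N + 1\<close>. The eigenvalues of this operator are the values of \<^term>\<open>dft N s\<close>.
\<close>

definition stencil_solution :: "nat \<Rightarrow> (int \<Rightarrow> real) \<Rightarrow> (int \<Rightarrow> real) \<Rightarrow> (int \<Rightarrow> real) \<Rightarrow> bool" where
  "stencil_solution N s f u \<longleftrightarrow>
     (\<forall>i. u (i + (2 * int N + 1)) = u i) \<and>
     (\<forall>i. (\<Sum>n = - int N..int N. s n * u (i - n)) = f i)"

definition grid_mean :: "nat \<Rightarrow> (int \<Rightarrow> real) \<Rightarrow> real" where
  "grid_mean N f = (\<Sum>n = - int N..int N. f n) / (2 * real N + 1)"

end

theory Submission
  imports Defs
begin

text \<open>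
  With \<open>s = \<alpha> / 2\<close>, the symbol is \<open>|1 - z|\<close> to the power \<open>2 * s\<close> on the unit circle, hence the
  squared modulus of the binomial series of \<open>(1 - z)\<close> to the power \<open>s\<close>, which converges absolutely
  on the closed disc. Its Fourier coefficients are therefore the autocorrelations of the binomial
  coefficients, and Gauss's summation theorem identifies them with the exact coefficients. Sampling
  the absolutely convergent Fourier series turns the trapezoidal rule into the aliasing sum. All
  exact coefficients except the central one are negative and decay like \<open>|n|\<close> to the power
  \<open>- 1 - \<alpha>\<close>, so the error is positive, and its sum over the stencil is of order \<open>N\<close> to the
  power \<open>- \<alpha>\<close>, which the scaling by \<open>h\<close> to the power \<open>- \<alpha>\<close> makes \<open>O(1)\<close>. For the solutions,
  the eigenvalue at frequency 0 relates the means of right-hand side and solution; it is positive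
  and bounded for the exact stencil but negative for the trapezoidal one.
\<close>

section \<open>Gauss's summation theorem\<close>

text \<open>The \<open>k\<close>-th term of Gauss's series 2F1(a, b; c; x) at x = 1.\<close>

definition hypergeom_term :: "real \<Rightarrow> real \<Rightarrow> real \<Rightarrow> nat \<Rightarrow> real" where
  "hypergeom_term a b c k = pochhammer a k * pochhammer b k / (fact k * pochhammer c k)"

lemma hypergeom_term_0 [simp]: "hypergeom_term a b c 0 = 1"
  by (simp add: hypergeom_term_def)

text \<open>After the leading factors \<open>c\<close> and \<open>c + real m\<close> are split off,
  the other factors only grow under the shift. The leading factors supply the gain
  \<open>c / (c + real m)\<close> for the terms below.\<close>

lemma pochhammer_shift_ge:
  fixes c :: real
  assumes "c > 0" "k \<ge> 1"
  shows "(c + real m) * pochhammer c k \<le> c * pochhammer (c + real m) k"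
proof -
  obtain j where k: "k = Suc j" using assms(2) by (cases k) auto
  have "pochhammer (c + 1) j \<le> pochhammer (c + real m + 1) j"
    unfolding pochhammer_prod by (rule prod_mono) (use assms in auto)
  then have "c * (c + real m) * pochhammer (c + 1) j \<le> c * (c + real m) * pochhammer (c + real m + 1) j"
    using assms by (intro mult_left_mono) auto
  then show ?thesis by (simp add: k pochhammer_rec mult_ac add_ac)
qed

text \<open>The gain is uniform in \<open>k\<close>, so as \<open>m\<close> grows the series with
  parameter \<open>c + real m\<close> is reduced to its zeroth term 1.\<close>

lemma abs_hypergeom_term_shift_le:
  assumes "c > 0" "k \<ge> 1"
  shows "\<bar>hypergeom_term a b (c + real m) k\<bar> \<le> c / (c + real m) * \<bar>hypergeom_term a b c k\<bar>"
proof -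
  have p: "pochhammer c k > 0" "pochhammer (c + real m) k > 0"
    using assms by (auto intro!: pochhammer_pos)
  have "1 / pochhammer (c + real m) k \<le> c / (c + real m) * (1 / pochhammer c k)"
    using pochhammer_shift_ge[OF assms, of m] p assms by (simp add: divide_simps mult_ac)
  then have "\<bar>pochhammer a k * pochhammer b k\<bar> / fact k * (1 / pochhammer (c + real m) k)
      \<le> \<bar>pochhammer a k * pochhammer b k\<bar> / fact k * (c / (c + real m) * (1 / pochhammer c k))"
    by (intro mult_left_mono) auto
  then show ?thesis using p by (simp add: hypergeom_term_def abs_mult mult_ac)
qed

lemma abs_hypergeom_term_shift_le':
  assumes "c > 0"
  shows "\<bar>hypergeom_term a b (c + real m) k\<bar> \<le> \<bar>hypergeom_term a b c k\<bar>"
proof (cases "k = 0")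
  case False
  have "c / (c + real m) * \<bar>hypergeom_term a b c k\<bar> \<le> 1 * \<bar>hypergeom_term a b c k\<bar>"
    using assms by (intro mult_right_mono) auto
  with abs_hypergeom_term_shift_le[of c k a b m] False assms show ?thesis by simp
qed (simp add: hypergeom_term_def)

text \<open>
  The difference of the two sides telescopes, with antidifference
  \<open>- c * k * hypergeom_term a b c k\<close>.
\<close>

lemma hypergeom_contiguous:
  assumes c: "c > 0"
    and s: "summable (hypergeom_term a b c)" "summable (hypergeom_term a b (c + 1))"
    and lim: "(\<lambda>k. real k * hypergeom_term a b c k) \<longlonglongrightarrow> 0"
  shows "c * (c - a - b) * suminf (hypergeom_term a b c)
       = (c - a) * (c - b) * suminf (hypergeom_term a b (c + 1))"
proof -
  let ?t = "hypergeom_term a b c" and ?u = "hypergeom_term a b (c + 1)"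
  let ?G = "\<lambda>k. c * (real k * ?t k)"
  have step: "?G k - ?G (Suc k) = c * (c - a - b) * ?t k - (c - a) * (c - b) * ?u k" for k
  proof -
    have pc: "pochhammer c k > 0" using c by (rule pochhammer_pos)
    \<comment> \<open>Both sides are \<open>pochhammer c (Suc k)\<close>, with the first or the last
      factor split off.\<close>
    have "c * pochhammer (c + 1) k = pochhammer c k * (c + real k)"
      by (metis pochhammer_Suc pochhammer_rec)
    then have "pochhammer (c + 1) k = pochhammer c k * (c + real k) / c"
      using c by (simp add: field_simps)
    then have u: "?u k = ?t k * c / (c + real k)"
      using c pc by (simp add: hypergeom_term_def mult_ac)
    have "?t (Suc k) = ?t k * ((a + real k) * (b + real k) / (real (Suc k) * (c + real k)))"
      unfolding hypergeom_term_def pochhammer_Suc fact_Suc by (simp add: mult_ac)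
    then have t: "real (Suc k) * ?t (Suc k) = ?t k * ((a + real k) * (b + real k) / (c + real k))"
      by (simp del: of_nat_Suc)
    show ?thesis
      unfolding t u using c by (simp add: field_simps)
  qed
  have "?G \<longlonglongrightarrow> c * 0" by (intro tendsto_intros lim)
  \<comment> \<open>The total is 0: the limit is 0 by \<open>lim\<close>, and \<open>?G 0\<close>
    vanishes because of its factor \<open>k\<close>.\<close>
  then have "(\<lambda>k. ?G k - ?G (Suc k)) sums (?G 0 - 0)"
    by (intro telescope_sums') simp
  moreover have "(\<lambda>k. ?G k - ?G (Suc k)) sums
      (c * (c - a - b) * suminf ?t - (c - a) * (c - b) * suminf ?u)"
    unfolding step by (intro sums_diff sums_mult summable_sums s)
  ultimately have "?G 0 - 0 = c * (c - a - b) * suminf ?t - (c - a) * (c - b) * suminf ?u"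
    by (rule sums_unique2)
  then show ?thesis by simp
qed

text \<open>Iterates the contiguous relation, whose multipliers collect into Pochhammer symbols.
  Summability and the limit carry over from \<open>c\<close> to \<open>c + real m\<close> by
  termwise comparison.\<close>

lemma hypergeom_sum_shift:
  assumes c: "c > 0" "c - a - b > 0"
    and s: "summable (\<lambda>k. \<bar>hypergeom_term a b c k\<bar>)"
    and lim: "(\<lambda>k. real k * hypergeom_term a b c k) \<longlonglongrightarrow> 0"
  shows "pochhammer c m * pochhammer (c - a - b) m * suminf (hypergeom_term a b c)
       = pochhammer (c - a) m * pochhammer (c - b) m * suminf (hypergeom_term a b (c + real m))"
proof (induction m)
  case (Suc m)
  have sm: "summable (hypergeom_term a b (c + real m))" for m
    by (rule summable_comparison_test'[OF s, of 0])
       (use abs_hypergeom_term_shift_le'[OF c(1)] in auto)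
  have lim': "(\<lambda>k. real k * hypergeom_term a b (c + real m) k) \<longlonglongrightarrow> 0"
  proof (rule Lim_null_comparison)
    show "(\<lambda>k. \<bar>real k * hypergeom_term a b c k\<bar>) \<longlonglongrightarrow> 0"
      using lim by (rule tendsto_rabs_zero)
    show "\<forall>\<^sub>F k in sequentially. norm (real k * hypergeom_term a b (c + real m) k)
        \<le> \<bar>real k * hypergeom_term a b c k\<bar>"
      by (intro always_eventually allI)
         (auto simp: abs_mult intro!: mult_left_mono abs_hypergeom_term_shift_le' c)
  qed
  have "(c + m) * (c + m - a - b) * suminf (hypergeom_term a b (c + real m))
      = (c + m - a) * (c + m - b) * suminf (hypergeom_term a b (c + real (Suc m)))"
    using hypergeom_contiguous[of "c + real m" a b] c sm[of m] sm[of "Suc m"] lim'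
    by (simp add: add_ac)
  with Suc show ?case unfolding pochhammer_Suc
    by (simp add: algebra_simps) algebra
qed simp

text \<open>In the \<open>m\<close>-fold shift relation let \<open>m\<close> tend to infinity: the
  shifted series tends to 1, and the Pochhammer quotient becomes a quotient of Gamma values by
  Gauss's product limit \<open>Gamma_series\<close>.\<close>

theorem Gauss_summation:
  assumes c: "c > 0" "c - a - b > 0" "c - a > 0" "c - b > 0"
    and s: "summable (\<lambda>k. \<bar>hypergeom_term a b c k\<bar>)"
    and lim: "(\<lambda>k. real k * hypergeom_term a b c k) \<longlonglongrightarrow> 0"
  shows "suminf (hypergeom_term a b c) = Gamma c * Gamma (c - a - b) / (Gamma (c - a) * Gamma (c - b))"
proof -
  let ?D = "\<lambda>m. suminf (hypergeom_term a b (c + real m))"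
  let ?S = "suminf (\<lambda>k. \<bar>hypergeom_term a b c (Suc k)\<bar>)"
  have sm: "summable (\<lambda>k. \<bar>hypergeom_term a b (c + real m) k\<bar>)" for m
    by (rule summable_comparison_test'[OF s, of 0])
       (use abs_hypergeom_term_shift_le'[OF c(1)] in auto)
  have sS: "summable (\<lambda>k. \<bar>hypergeom_term a b (c + real m) (Suc k)\<bar>)" for m
    using summable_ignore_initial_segment[OF sm[of m], of 1] by simp
  have bound: "\<bar>?D m - 1\<bar> \<le> c / (c + real m) * ?S" for m
  proof -
    have "?D m - 1 = suminf (\<lambda>k. hypergeom_term a b (c + real m) (Suc k))"
      using suminf_split_head[OF summable_rabs_cancel[OF sm[of m]]]
      by (simp add: hypergeom_term_0)
    then have "\<bar>?D m - 1\<bar> \<le> suminf (\<lambda>k. \<bar>hypergeom_term a b (c + real m) (Suc k)\<bar>)"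
      using summable_rabs[OF sS[of m]] by simp
    also have "\<dots> \<le> suminf (\<lambda>k. c / (c + real m) * \<bar>hypergeom_term a b c (Suc k)\<bar>)"
      using sS[of 0] by (intro suminf_le sS summable_mult abs_hypergeom_term_shift_le c) auto
    also have "\<dots> = c / (c + real m) * ?S"
      using sS[of 0] by (intro suminf_mult) auto
    finally show ?thesis .
  qed
  have "(\<lambda>m. c / (c + real m)) \<longlonglongrightarrow> 0" 
    by (intro tendsto_divide_0[OF tendsto_const] filterlim_at_top_imp_at_infinity
        filterlim_tendsto_add_at_top[OF tendsto_const] filterlim_real_sequentially)
  then have lz: "(\<lambda>m. c / (c + real m) * ?S) \<longlonglongrightarrow> 0"
    by (rule tendsto_mult_left_zero)
  have "(\<lambda>m. ?D m - 1) \<longlonglongrightarrow> 0"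
    by (rule Lim_null_comparison[OF _ lz]) (use bound in auto)
  then have D1: "?D \<longlonglongrightarrow> 1" by (simp add: LIM_zero_iff)
  \<comment> \<open>The denominator of \<open>Gamma_series x m\<close> is
    \<open>pochhammer x (Suc m)\<close>, hence the shift by \<open>Suc m\<close>.\<close>
  have ratio: "suminf (hypergeom_term a b c) =
      Gamma_series c m * Gamma_series (c - a - b) m
      / (Gamma_series (c - a) m * Gamma_series (c - b) m) * ?D (Suc m)" for m
  proof -
    have "pochhammer x (Suc m) > 0" if "x > 0" for x :: real
      using that by (rule pochhammer_pos)
    note pos = this[OF c(1)] this[OF c(2)] this[OF c(3)] this[OF c(4)]
    \<comment> \<open>The exponents of \<open>m\<close> have the same sum on both sides, so the
      powers of \<open>m\<close> cancel in the quotient.\<close>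
    have e: "exp (c * ln (real m)) * exp ((c - a - b) * ln (real m))
        = exp ((c - a) * ln (real m)) * exp ((c - b) * ln (real m))"
      by (simp add: exp_add[symmetric] algebra_simps)
    define P where "P = exp ((c - a) * ln (real m))"
    define Q where "Q = exp ((c - b) * ln (real m))"
    define R where "R = exp (c * ln (real m))"
    define T where "T = exp ((c - a - b) * ln (real m))"
    have "R * T = P * Q" "P > 0" "Q > 0" using e by (auto simp: P_def Q_def R_def T_def)
    then have PQ: "R * T / (P * Q) = 1" by simp
    have "Gamma_series c m * Gamma_series (c - a - b) m
      / (Gamma_series (c - a) m * Gamma_series (c - b) m) = 
      (R * T / (P * Q)) * (pochhammer (c-a) (Suc m) * pochhammer (c-b) (Suc m)
       / (pochhammer c (Suc m) * pochhammer (c-a-b) (Suc m)))"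
      unfolding Gamma_series_def P_def Q_def R_def T_def using pos
      by (simp add: divide_simps del: pochhammer_Suc)
    also have "\<dots> = pochhammer (c-a) (Suc m) * pochhammer (c-b) (Suc m)
       / (pochhammer c (Suc m) * pochhammer (c-a-b) (Suc m))" unfolding PQ by simp
    finally have G: "Gamma_series c m * Gamma_series (c - a - b) m
      / (Gamma_series (c - a) m * Gamma_series (c - b) m) = \<dots>" .
    show ?thesis
      unfolding G using hypergeom_sum_shift[OF c(1,2) s lim, of "Suc m"] pos
      by (simp add: divide_simps mult_ac)
  qed
  have nz: "Gamma (c - a) \<noteq> 0" "Gamma (c - b) \<noteq> 0"
    using Gamma_real_pos[OF c(3)] Gamma_real_pos[OF c(4)] by auto
  have "(\<lambda>m. Gamma_series c m * Gamma_series (c - a - b) m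
      / (Gamma_series (c - a) m * Gamma_series (c - b) m) * ?D (Suc m)) 
    \<longlonglongrightarrow> Gamma c * Gamma (c - a - b) / (Gamma (c - a) * Gamma (c - b)) * 1"
    by (intro tendsto_intros Gamma_series_LIMSEQ LIMSEQ_Suc[OF D1]) (use nz in simp)
  then have "(\<lambda>m. suminf (hypergeom_term a b c))
     \<longlonglongrightarrow> Gamma c * Gamma (c - a - b) / (Gamma (c - a) * Gamma (c - b))"
    unfolding ratio[symmetric] by simp
  then show ?thesis by (rule LIMSEQ_unique[OF tendsto_const])
qed

section \<open>The binomial series on the closed unit disc\<close>

text \<open>The coefficient of \<open>z ^ k\<close> in the expansion of
  \<open>(1 - z) powr s\<close>, that is, \<open>(-1) ^ k * (s gchoose k)\<close>.\<close>

definition binom_coeff :: "real \<Rightarrow> nat \<Rightarrow> real" where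
  "binom_coeff s k = pochhammer (- s) k / fact k"

lemma binom_coeff_0 [simp]: "binom_coeff s 0 = 1"
  by (simp add: binom_coeff_def)

lemma binom_coeff_Suc: "real (Suc k) * binom_coeff s (Suc k) = (real k - s) * binom_coeff s k"
  by (simp add: binom_coeff_def pochhammer_Suc mult_ac del: of_nat_Suc)

context
  fixes s :: real
  assumes s: "0 < s" "s < 1"
begin

text \<open>Only the leading factor \<open>- s\<close> of the Pochhammer symbol is negative.\<close>

lemma binom_coeff_neg: "binom_coeff s (Suc k) < 0"
proof -
  have "pochhammer (1 - s) k > 0" using s by (intro pochhammer_pos) auto
  then have "(-s) * pochhammer (-s + 1) k < 0" using s by (intro mult_neg_pos) auto
  then show ?thesis by (simp add: binom_coeff_def pochhammer_rec divide_less_0_iff)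
qed

lemma binom_coeff_nonzero: "binom_coeff s k \<noteq> 0"
  using binom_coeff_neg[of "k - 1"] by (cases k) auto

text \<open>Dividing a power series by \<open>1 - z\<close> sums its coefficients, so the partial
  sums are the coefficients for the exponent \<open>s - 1\<close>. Here it matters that they are
  nonnegative.\<close>

lemma sum_binom_coeff: "(\<Sum>k\<le>K. binom_coeff s k) = pochhammer (1 - s) K / fact K"
proof (induction K)
  case (Suc K)
  have "binom_coeff s (Suc K) = (-s) * pochhammer (1 - s) K / fact (Suc K)"
    by (simp add: binom_coeff_def pochhammer_rec del: fact_Suc)
  moreover have "pochhammer (1 - s) K / fact K = real (Suc K) * pochhammer (1 - s) K / fact (Suc K)"
    by (simp del: of_nat_Suc)
  ultimately have "(\<Sum>k\<le>Suc K. binom_coeff s k)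
      = (real (Suc K) * pochhammer (1 - s) K + (-s) * pochhammer (1 - s) K) / fact (Suc K)"
    using Suc by (simp only: sum.atMost_Suc add_divide_distrib)
  then show ?case by (simp add: pochhammer_Suc algebra_simps del: fact_Suc)
qed (simp add: binom_coeff_def)

text \<open>All terms but the zeroth are negative, so the absolute sum is 2 minus a nonnegative
  partial sum. This gives absolute convergence up to the unit circle.\<close>

lemma sum_abs_binom_coeff: "(\<Sum>k<K. \<bar>binom_coeff s k\<bar>) \<le> 2"
proof -
  have "(\<Sum>k\<le>K. \<bar>binom_coeff s k\<bar>) = 2 - (\<Sum>k\<le>K. binom_coeff s k)" for K
    by (induction K) (auto simp: abs_of_neg binom_coeff_neg)
  moreover have "(\<Sum>k\<le>K. binom_coeff s k) \<ge> 0" for K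
    unfolding sum_binom_coeff using s by (intro divide_nonneg_nonneg pochhammer_nonneg) auto
  ultimately have "(\<Sum>k\<le>K. \<bar>binom_coeff s k\<bar>) \<le> 2" for K by (smt (verit))
  moreover have "(\<Sum>k<K. \<bar>binom_coeff s k\<bar>) \<le> (\<Sum>k\<le>K. \<bar>binom_coeff s k\<bar>)"
    by (intro sum_mono2) auto
  ultimately show ?thesis by (meson order_trans)
qed

lemma summable_abs_binom_coeff: "summable (\<lambda>k. \<bar>binom_coeff s k\<bar>)"
  by (rule summableI_nonneg_bounded[of _ 2]) (auto intro: sum_abs_binom_coeff)

lemma abs_binom_coeff_le: "\<bar>binom_coeff s k\<bar> \<le> 2"
proof -
  have "\<bar>binom_coeff s k\<bar> \<le> (\<Sum>k<Suc k. \<bar>binom_coeff s k\<bar>)"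
    by (intro member_le_sum) auto
  then show ?thesis using sum_abs_binom_coeff[of "Suc k"] by linarith
qed

text \<open>By the recurrence the left-hand side does not increase from \<open>k = 1\<close> on,
  where it equals \<open>s\<close>. The bound serves the limit hypothesis of Gauss's
  theorem.\<close>

lemma mult_abs_binom_coeff_le: "real k * \<bar>binom_coeff s k\<bar> \<le> s"
proof (cases k)
  case (Suc j)
  have "real (Suc j) * \<bar>binom_coeff s (Suc j)\<bar> \<le> s"
  proof (induction j)
    case 0
    show ?case using binom_coeff_Suc[of 0 s] s by simp
  next
    case (Suc j)
    have "real (Suc (Suc j)) * \<bar>binom_coeff s (Suc (Suc j))\<bar>
        = \<bar>real (Suc (Suc j)) * binom_coeff s (Suc (Suc j))\<bar>" by (simp add: abs_mult)
    also have "\<dots> = \<bar>real (Suc j) - s\<bar> * \<bar>binom_coeff s (Suc j)\<bar>"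
      unfolding binom_coeff_Suc by (simp add: abs_mult)
    also have "\<dots> \<le> real (Suc j) * \<bar>binom_coeff s (Suc j)\<bar>"
      using s by (intro mult_right_mono) auto
    finally show ?case using Suc by linarith
  qed
  with Suc show ?thesis by simp
qed (use s in auto)

text \<open>In the open disc this is the binomial theorem. Both sides are continuous on the closed
  disc, the series by uniform convergence, so the identity extends to the circle. Taking norms
  avoids the complex power at its branch point \<open>z = 1\<close>.\<close>

lemma norm_binom_series:
  fixes z :: complex
  assumes "norm z \<le> 1"
  shows "norm (\<Sum>k. of_real (binom_coeff s k) * z ^ k) = norm (1 - z) powr s"
proof -
  let ?B = "\<lambda>z::complex. \<Sum>k. of_real (binom_coeff s k) * z ^ k"
  have "uniform_limit (cball 0 1) (\<lambda>n z. \<Sum>k<n. of_real (binom_coeff s k) * z ^ k) ?B sequentially"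
  proof (rule Weierstrass_m_test[OF _ summable_abs_binom_coeff])
    fix n and z :: complex assume "z \<in> cball 0 1"
    then have "norm z ^ n \<le> 1" by (intro power_le_one) auto
    then show "norm (of_real (binom_coeff s n) * z ^ n) \<le> \<bar>binom_coeff s n\<bar>"
      by (simp add: norm_mult norm_power mult_left_le)
  qed
  then have "continuous_on (cball 0 1) ?B"
    by (rule uniform_limit_theorem[rotated])
       (auto intro!: always_eventually continuous_intros)
  then have "continuous_on (cball 0 1) (\<lambda>z. norm (?B z) - norm (1 - z) powr s)"
    using s by (auto intro!: continuous_intros continuous_on_powr')
  then have "continuous_on (closure (ball 0 1)) (\<lambda>z. norm (?B z) - norm (1 - z) powr s)"
    by simp
  then have "norm (?B z) - norm (1 - z) powr s = 0"
  proof (rule continuous_constant_on_closure)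
    show "z \<in> closure (ball 0 1)" using assms by simp
    fix w :: complex assume "w \<in> ball 0 1"
    then have w: "norm w < 1" by simp
    have "(\<lambda>n. (of_real s gchoose n) * (- w) ^ n) sums (1 + - w) powr of_real s"
      using w by (intro gen_binomial_complex) simp
    moreover have "(of_real s gchoose n) * (- w) ^ n = of_real (binom_coeff s n) * w ^ n" for n
    proof -
      have "pochhammer (- complex_of_real s) n = of_real (pochhammer (- s) n)"
        by (metis of_real_minus pochhammer_of_real)
      then show ?thesis
        by (simp add: gbinomial_pochhammer binom_coeff_def uminus_power_if)
    qed
    ultimately have "?B w = (1 - w) powr of_real s" by (simp add: sums_iff)
    then show "norm (?B w) - norm (1 - w) powr s = 0"
      by (simp add: norm_powr_real_powr')
  qed
  then show ?thesis by simp
qed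

text \<open>As \<open>s\<close> is no integer, \<open>Gamma (s - real n + 1)\<close> is not taken at
  a pole and can be traded for a Pochhammer symbol. Reflecting that symbol produces a sign
  \<open>(-1) ^ n\<close>, which cancels the sign in \<open>exact_coeff\<close>.\<close>

lemma exact_coeff_pochhammer:
  "exact_coeff (2 * s) (int n)
     = pochhammer (- s) n * Gamma (1 + 2 * s) / (Gamma (real n + 1 + s) * Gamma (1 + s))"
proof -
  have "s - real n + 1 \<notin> \<int>\<^sub>\<le>\<^sub>0"
  proof
    assume "s - real n + 1 \<in> \<int>\<^sub>\<le>\<^sub>0"
    then obtain m :: int where "s - real n + 1 = of_int m" by (elim nonpos_Ints_cases) auto
    then have "s = of_int (m + int n - 1)" by simp
    then have "0 < m + int n - 1" "m + int n - 1 < 1" using s by linarith+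
    then show False by simp
  qed
  then have "pochhammer (s - real n + 1) n = Gamma (s - real n + 1 + real n) / Gamma (s - real n + 1)"
    by (rule pochhammer_Gamma)
  moreover have "pochhammer (- s) n = (-1) ^ n * pochhammer (s - real n + 1) n"
    by (rule pochhammer_minus)
  ultimately have "pochhammer (- s) n = (-1) ^ n * Gamma (1 + s) / Gamma (s - real n + 1)"
    by (simp add: add.commute)
  moreover have "Gamma (1 + s) \<noteq> 0"
    using s by (intro less_imp_neq[symmetric] Gamma_real_pos) auto
  ultimately show ?thesis
    by (simp add: exact_coeff_def gamma_binomial_def add_ac mult_ac)
qed

lemma summable_abs_binom_product:
  "summable (\<lambda>p. \<bar>binom_coeff s p * binom_coeff s (p + n)\<bar>)"
proof -
  have "\<bar>binom_coeff s p * binom_coeff s (p + n)\<bar> \<le> 2 * \<bar>binom_coeff s p\<bar>" for p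
    using mult_left_mono[OF abs_binom_coeff_le, of "\<bar>binom_coeff s p\<bar>" "p + n"]
    by (simp add: abs_mult)
  then show ?thesis
    by (intro summable_comparison_test'[OF summable_mult[OF summable_abs_binom_coeff, of 2], of 0]) auto
qed

text \<open>Dividing by the term \<open>p = 0\<close>, which is \<open>binom_coeff s n\<close>,
  leaves Gauss's series 2F1(-s, n - s; n + 1; 1), whose excess \<open>c - a - b\<close> is
  \<open>1 + 2 * s\<close>.\<close>

lemma binom_coeff_autocorrelation:
  "(\<lambda>p. binom_coeff s p * binom_coeff s (p + n)) sums exact_coeff (2 * s) (int n)"
proof -
  let ?t = "hypergeom_term (- s) (real n - s) (real n + 1)"
  have t: "binom_coeff s p * binom_coeff s (p + n) = binom_coeff s n * ?t p" for p
  proof -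
    have 1: "pochhammer (- s) (p + n) = pochhammer (- s) n * pochhammer (real n - s) p"
      using pochhammer_product'[of "-s" n p] by (simp add: add.commute)
    have 2: "fact (p + n) = fact n * pochhammer (real n + 1) p"
      using pochhammer_product'[of "1::real" n p] 
      by (simp add: add.commute pochhammer_fact)
    show ?thesis unfolding binom_coeff_def hypergeom_term_def 1 2 by (simp add: mult_ac)
  qed
  have summ: "summable (\<lambda>p. binom_coeff s p * binom_coeff s (p + n))"
    by (rule summable_rabs_cancel[OF summable_abs_binom_product])
  have t': "?t p = binom_coeff s p * binom_coeff s (p + n) / binom_coeff s n" for p
    using t[of p] binom_coeff_nonzero[of n] by (simp add: field_simps)
  have "suminf ?t = Gamma (real n + 1) * Gamma (1 + 2 * s) / (Gamma (real n + 1 + s) * Gamma (1 + s))"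
  proof -
    have "suminf ?t = Gamma (real n + 1) * Gamma (real n + 1 - (-s) - (real n - s))
        / (Gamma (real n + 1 - (-s)) * Gamma (real n + 1 - (real n - s)))"
    proof (rule Gauss_summation)
      show "summable (\<lambda>k. \<bar>?t k\<bar>)"
        unfolding t' abs_divide by (intro summable_divide summable_abs_binom_product)
      \<comment> \<open>One coefficient absorbs the factor \<open>k\<close> and stays bounded by
        \<open>s\<close>; the other one tends to 0.\<close>
      have "(\<lambda>k. \<bar>binom_coeff s (k + n)\<bar>) \<longlonglongrightarrow> 0"
        by (intro LIMSEQ_ignore_initial_segment summable_LIMSEQ_zero summable_abs_binom_coeff)
      then have "(\<lambda>k. s * \<bar>binom_coeff s (k + n)\<bar>) \<longlonglongrightarrow> 0"
        by (rule tendsto_mult_right_zero)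
      then have "(\<lambda>k. real k * binom_coeff s k * binom_coeff s (k + n)) \<longlonglongrightarrow> 0"
        by (rule Lim_null_comparison[rotated])
           (auto simp: abs_mult intro!: always_eventually mult_right_mono mult_abs_binom_coeff_le)
      then have "(\<lambda>k. real k * binom_coeff s k * binom_coeff s (k + n) / binom_coeff s n) \<longlonglongrightarrow> 0"
        by (rule tendsto_divide_zero)
      then show "(\<lambda>k. real k * ?t k) \<longlonglongrightarrow> 0" unfolding t' by (simp add: mult_ac)
    qed (use s in auto)
    then show ?thesis by (simp add: algebra_simps)
  qed
  moreover have "Gamma (real n + 1) = fact n" by (metis Gamma_fact add.commute)
  moreover from this have "binom_coeff s n * (Gamma (real n + 1) * Gamma (1 + 2 * s) / (Gamma (real n + 1 + s) * Gamma (1 + s)))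
      = exact_coeff (2 * s) (int n)"
    by (simp add: binom_coeff_def exact_coeff_pochhammer)
  ultimately have "(\<Sum>p. binom_coeff s p * binom_coeff s (p + n)) = exact_coeff (2 * s) (int n)"
    unfolding t
    using suminf_mult[of ?t "binom_coeff s n"] summable_divide[OF summ, of "binom_coeff s n"]
    by (simp flip: t')
  then show ?thesis using summ by (simp add: sums_iff)
qed

end

section \<open>Fourier series of the symbol\<close>

text \<open>Negating \<open>n\<close> swaps the two Gamma factors of the denominator.\<close>

lemma exact_coeff_minus [simp]: "exact_coeff \<alpha> (- n) = exact_coeff \<alpha> n"
  by (simp add: exact_coeff_def gamma_binomial_def power_int_minus_one_minus mult_ac)

lemma exact_coeff_abs [simp]: "exact_coeff \<alpha> \<bar>n\<bar> = exact_coeff \<alpha> n"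
  by (simp add: abs_if)

lemma norm_1_minus_cis: "(norm (1 - cis \<omega>))\<^sup>2 = 4 * (sin (\<omega> / 2))\<^sup>2"
proof -
  have "(norm (1 - cis \<omega>))\<^sup>2 = 2 - 2 * cos \<omega>"
    using sin_cos_squared_add[of \<omega>] unfolding cmod_power2 by (simp add: power2_eq_square algebra_simps)
  also have "cos \<omega> = 1 - 2 * (sin (\<omega> / 2))\<^sup>2"
    using cos_double_sin[of "\<omega> / 2"] by simp
  finally show ?thesis by simp
qed

text \<open>The symbol is \<open>A * cnj A\<close>, where \<open>A\<close> is the binomial series at
  \<open>cis \<omega>\<close>. Grouping the double series by the index difference \<open>n\<close>
  makes each inner sum an autocorrelation of the binomial coefficients.\<close>

lemma exact_coeff_fourier:
  assumes s: "0 < s" "s < 1"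
  shows "((\<lambda>n::int. exact_coeff (2 * s) n * cos (of_int n * \<omega>)) has_sum stencil_symbol (2 * s) \<omega>) UNIV"
proof -
  define a where "a k = of_real (binom_coeff s k) * cis \<omega> ^ k" for k
  define A where "A = (\<Sum>k. a k)"
  have na: "norm (a k) = \<bar>binom_coeff s k\<bar>" for k
    by (simp add: a_def norm_mult norm_power)
  have suma: "summable (\<lambda>k. norm (a k))"
    unfolding na by (rule summable_abs_binom_coeff[OF s])
  have asum: "(a has_sum A) UNIV"
    unfolding A_def by (intro norm_summable_imp_has_sum summable_sums suma summable_norm_cancel[OF suma])
  have aabs: "(\<lambda>k. norm (a k)) summable_on UNIV"
    using suma by (intro norm_summable_imp_summable_on) simp
  \<comment> \<open>Absolute summability over all pairs justifies both the product formula and the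
    regrouping.\<close>
  have "(\<lambda>x. norm (case x of (j, k) \<Rightarrow> a j * cnj (a k))) summable_on UNIV \<times> UNIV"
    unfolding Infinite_Sum.abs_summable_on_Sigma_iff
    using aabs by (auto simp: norm_mult abs_mult infsum_cmult_right intro!: summable_on_cmult_right summable_on_cmult_left)
  then have "(\<lambda>(j, k). a j * cnj (a k)) summable_on UNIV \<times> UNIV"
    by (rule abs_summable_summable)
  then have "((\<lambda>(j, k). a j * cnj (a k)) has_sum A * cnj A) (UNIV \<times> UNIV)"
    by (intro has_sum_SigmaI[where g = "\<lambda>j. a j * cnj A"])
       (auto intro!: has_sum_cmult_left has_sum_cmult_right simp: asum)
  then have "((\<lambda>x. Re (case x of (j, k) \<Rightarrow> a j * cnj (a k))) has_sum Re (A * cnj A)) (UNIV \<times> UNIV)"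
    by (rule has_sum_Re)
  moreover have "Re (A * cnj A) = stencil_symbol (2 * s) \<omega>"
  proof -
    have "norm A = norm (1 - cis \<omega>) powr s"
      unfolding A_def a_def by (rule norm_binom_series[OF s]) simp
    then have "Re (A * cnj A) = (norm (1 - cis \<omega>) powr s)\<^sup>2"
      by (simp add: complex_mult_cnj flip: cmod_power2)
    also have "\<dots> = (norm (1 - cis \<omega>))\<^sup>2 powr s"
      by (simp add: power2_eq_square powr_mult)
    finally show ?thesis by (simp add: norm_1_minus_cis stencil_symbol_def)
  qed
  moreover have "Re (case x of (j, k) \<Rightarrow> a j * cnj (a k)) = (case x of (j, k) \<Rightarrow>
      binom_coeff s j * binom_coeff s k * cos ((real j - real k) * \<omega>))" for x
    by (auto simp: a_def Complex.DeMoivre cos_diff algebra_simps split: prod.split)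
  moreover have nat_diff: "a + nat (int b - int a) = b" if "a \<le> b" for a b
    using that by linarith
  ultimately have "((\<lambda>(j, k). binom_coeff s j * binom_coeff s k * cos ((real j - real k) * \<omega>))
      has_sum stencil_symbol (2 * s) \<omega>) (UNIV \<times> UNIV)"
    by simp
  also have "?this \<longleftrightarrow> ((\<lambda>(n, p). binom_coeff s (p + nat n) * binom_coeff s (p + nat (- n)) * cos (of_int n * \<omega>))
      has_sum stencil_symbol (2 * s) \<omega>) ((UNIV :: int set) \<times> (UNIV :: nat set))"
    \<comment> \<open>A pair corresponds to its difference \<open>n\<close> and its minimum
      \<open>p\<close>; one of \<open>nat n\<close> and \<open>nat (- n)\<close> is 0.\<close>
    by (rule has_sum_reindex_bij_witness[where i = "\<lambda>(n, p). (p + nat n, p + nat (- n))"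
          and j = "\<lambda>(j, k). (int j - int k, min j k)"])
       (auto simp: min_def nat_diff)
  finally show ?thesis
  proof (rule has_sum_SigmaD)
    fix n :: int
    have "((\<lambda>p. binom_coeff s p * binom_coeff s (p + nat \<bar>n\<bar>)) has_sum exact_coeff (2 * s) (int (nat \<bar>n\<bar>))) UNIV"
      using summable_abs_binom_product[OF s] binom_coeff_autocorrelation[OF s, of "nat \<bar>n\<bar>"]
      by (intro norm_summable_imp_has_sum) auto
    then have "((\<lambda>p. binom_coeff s p * binom_coeff s (p + nat \<bar>n\<bar>) * cos (of_int n * \<omega>))
        has_sum exact_coeff (2 * s) n * cos (of_int n * \<omega>)) UNIV"
      by (intro has_sum_cmult_left) simp
    then show "((\<lambda>p. case (n, p) of (n, p) \<Rightarrow> binom_coeff s (p + nat n) * binom_coeff s (p + nat (- n)) * cos (of_int n * \<omega>))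
        has_sum exact_coeff (2 * s) n * cos (of_int n * \<omega>)) UNIV"
      by (cases "n \<ge> 0") (simp_all add: mult_ac)
  qed
qed

section \<open>Aliasing\<close>

lemma has_sum_sum_finite:
  fixes f :: "'a \<Rightarrow> 'b \<Rightarrow> 'c :: topological_comm_monoid_add"
  assumes "finite I" "\<And>i. i \<in> I \<Longrightarrow> (f i has_sum S i) A"
  shows "((\<lambda>x. \<Sum>i\<in>I. f i x) has_sum (\<Sum>i\<in>I. S i)) A"
  using assms by (induction I rule: finite_induct) (auto intro!: has_sum_add)

text \<open>The real part of a geometric sum over powers of an \<open>M\<close>-th root of unity,
  which is 1 exactly if \<open>M\<close> divides \<open>m\<close>.\<close>

lemma sum_cos_roots_of_unity:
  assumes "M > 0"
  shows "(\<Sum>j<M. cos (of_int m * (real j * (2 * pi / real M)))) = (if int M dvd m then real M else 0)"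
proof -
  define z where "z = cis (of_int m * (2 * pi / real M))"
  have zM: "z ^ M = 1" 
  proof -
    have "z ^ M = cis (real M * (of_int m * (2 * pi / real M)))" unfolding z_def by (rule Complex.DeMoivre)
    also have "real M * (of_int m * (2 * pi / real M)) = 2 * pi * of_int m" using assms by simp
    finally show ?thesis by (simp add: cis_multiple_2pi)
  qed
  have z1: "z = 1 \<longleftrightarrow> int M dvd m"
  proof
    assume "z = 1"
    then have "cos (of_int m * (2 * pi / real M)) = 1" by (simp add: z_def complex_eq_iff)
    then obtain k :: int where "of_int m * (2 * pi / real M) = of_int k * 2 * pi"
      by (auto simp: cos_one_2pi_int)
    then have "of_int m = (of_int (k * int M) :: real)" using assms by (simp add: field_simps)
    then have "m = k * int M" by (simp only: of_int_eq_iff)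
    then show "int M dvd m" by simp
  next
    assume "int M dvd m"
    then obtain k where "m = int M * k" ..
    then have "z = cis (2 * pi * of_int k)" using assms by (simp add: z_def mult_ac)
    then show "z = 1" by (simp add: cis_multiple_2pi)
  qed
  have "(\<Sum>j<M. cos (of_int m * (real j * (2 * pi / real M)))) = Re (\<Sum>j<M. z ^ j)"
    by (simp add: z_def Complex.DeMoivre mult_ac)
  also have "(\<Sum>j<M. z ^ j) = (if int M dvd m then of_nat M else 0)"
    by (cases "z = 1") (auto simp: z1[symmetric] geometric_sum zM)
  finally show ?thesis by simp
qed

text \<open>Discrete orthogonality, by the product-to-sum formula. When \<open>n\<close> is a
  multiple of \<open>N\<close> the two conditions coincide and the value doubles.\<close>

lemma sum_cos_cos:
  assumes "N \<ge> 1"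
  shows "(\<Sum>j<2*N. cos (of_int m * (real j * pi / real N)) * cos (of_int n * (real j * pi / real N)))
    = (if 2 * int N dvd m - n then real N else 0) + (if 2 * int N dvd m + n then real N else 0)"
proof -
  have "cos (of_int m * (real j * pi / real N)) * cos (of_int n * (real j * pi / real N))
      = (cos (of_int (m - n) * (real j * (2 * pi / real (2 * N))))
       + cos (of_int (m + n) * (real j * (2 * pi / real (2 * N))))) / 2" for j
    by (simp add: cos_times_cos algebra_simps diff_divide_distrib add_divide_distrib)
  then have "(\<Sum>j<2*N. cos (of_int m * (real j * pi / real N)) * cos (of_int n * (real j * pi / real N)))
     = ((\<Sum>j<2*N. cos (of_int (m - n) * (real j * (2 * pi / real (2 * N)))))
       + (\<Sum>j<2*N. cos (of_int (m + n) * (real j * (2 * pi / real (2 * N)))))) / 2"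
    by (simp only: sum.distrib sum_divide_distrib[symmetric])
  also have "\<dots> = ((if int (2 * N) dvd m - n then real (2 * N) else 0)
      + (if int (2 * N) dvd m + n then real (2 * N) else 0)) / 2"
    using assms by (subst (1 2) sum_cos_roots_of_unity) auto
  finally show ?thesis by auto
qed

text \<open>At frequency 0 all cosines in the Fourier series are 1, and unconditional summability
  passes to subsets.\<close>

lemma summable_exact_coeff:
  assumes "0 < \<alpha>" "\<alpha> < 2"
  shows "exact_coeff \<alpha> summable_on A"
proof -
  have "(exact_coeff \<alpha> has_sum stencil_symbol \<alpha> 0) UNIV"
    using exact_coeff_fourier[of "\<alpha> / 2" 0] assms by simp
  then show ?thesis
    by (intro summable_on_subset_banach[of _ UNIV A]) (auto simp: summable_on_def)
qed

text \<open>With the Fourier series inserted into the trapezoidal rule, orthogonality keeps only the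
  indices congruent to \<open>n\<close> or \<open>- n\<close> modulo \<open>2 * N\<close>, each with
  weight 1/2. As the coefficients are even, both classes contribute equally.\<close>

theorem fft_coeff_aliasing:
  assumes \<alpha>: "0 < \<alpha>" "\<alpha> < 2" and N: "N \<ge> 1"
  shows "((\<lambda>k::int. exact_coeff \<alpha> (n + 2 * int N * k)) has_sum fft_coeff \<alpha> N n) UNIV"
proof -
  let ?h = "exact_coeff \<alpha>"
  define w where "w j = real j * pi / real N" for j
  \<comment> \<open>The residue class of \<open>n\<close> modulo \<open>2 * N\<close>.\<close>
  define D where "D n = {m. 2 * int N dvd m - n}" for n
  have "((\<lambda>m. \<Sum>j<2*N. ?h m * cos (of_int m * w j) * cos (of_int n * w j))
      has_sum (\<Sum>j<2*N. stencil_symbol \<alpha> (w j) * cos (of_int n * w j))) UNIV"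
    using exact_coeff_fourier[of "\<alpha> / 2"] \<alpha>
    by (intro has_sum_sum_finite has_sum_cmult_left) auto
  then have "((\<lambda>m. (\<Sum>j<2*N. ?h m * cos (of_int m * w j) * cos (of_int n * w j)) / (2 * real N))
      has_sum fft_coeff \<alpha> N n) UNIV"
    unfolding fft_coeff_def w_def by (rule has_sum_divide_const)
  moreover have "(\<Sum>j<2*N. ?h m * cos (of_int m * w j) * cos (of_int n * w j)) / (2 * real N)
      = (if m \<in> D n then ?h m else 0) / 2 + (if m \<in> D (- n) then ?h m else 0) / 2" for m
    using sum_cos_cos[OF N, of m n] N
    by (auto simp: D_def w_def mult.assoc sum_distrib_left[symmetric] field_simps)
  ultimately have F: "((\<lambda>m. (if m \<in> D n then ?h m else 0) / 2 + (if m \<in> D (- n) then ?h m else 0) / 2)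
      has_sum fft_coeff \<alpha> N n) UNIV" by simp
  have "(?h has_sum infsum ?h (D n)) (D n)"
    by (intro has_sum_infsum summable_exact_coeff \<alpha>)
  \<comment> \<open>Negation maps \<open>D n\<close> onto \<open>D (- n)\<close> and preserves the
    coefficients.\<close>
  moreover have "(?h has_sum infsum ?h (D n)) (D n) \<longleftrightarrow> (?h has_sum infsum ?h (D n)) (D (- n))"
    by (rule has_sum_reindex_bij_witness[of _ uminus uminus])
       (auto simp: D_def dvd_diff_commute add.commute)
  moreover have "((\<lambda>m. if m \<in> B then ?h m else 0) has_sum S) UNIV"
    if "(?h has_sum S) B" for B S
    using that by (rule has_sum_cong_neutral[THEN iffD1, rotated -1]) auto
  ultimately have "((\<lambda>m. if m \<in> D n then ?h m else 0) has_sum infsum ?h (D n)) UNIV"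
      "((\<lambda>m. if m \<in> D (- n) then ?h m else 0) has_sum infsum ?h (D n)) UNIV"
    by blast+
  then have "((\<lambda>m. (if m \<in> D n then ?h m else 0) / 2 + (if m \<in> D (- n) then ?h m else 0) / 2)
      has_sum (infsum ?h (D n) / 2 + infsum ?h (D n) / 2)) UNIV"
    by (intro has_sum_add has_sum_divide_const)
  with F have "fft_coeff \<alpha> N n = infsum ?h (D n)" by (simp add: has_sum_unique)
  then have "(?h has_sum fft_coeff \<alpha> N n) (D n)"
    by (simp add: summable_exact_coeff \<alpha>)
  also have "?this \<longleftrightarrow> ?thesis"
    by (rule has_sum_reindex_bij_witness[of _ "\<lambda>k. n + 2 * int N * k" "\<lambda>m. (m - n) div (2 * int N)"])
       (use N in \<open>auto simp: D_def\<close>)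
  finally show ?thesis .
qed

section \<open>Sign and decay of the exact coefficients\<close>

lemma exact_coeff_0_pos:
  assumes "0 < \<alpha>"
  shows "exact_coeff \<alpha> 0 > 0"
  unfolding exact_coeff_def gamma_binomial_def
  using assms by (auto intro!: mult_pos_pos divide_pos_pos Gamma_real_pos)

text \<open>By evenness a positive index suffices; then all Gamma factors are positive and the
  Pochhammer symbol decides the sign.\<close>

lemma exact_coeff_neg:
  assumes "0 < \<alpha>" "\<alpha> < 2" "n \<noteq> 0"
  shows "exact_coeff \<alpha> n < 0"
proof -
  define s where "s = \<alpha> / 2"
  have s: "0 < s" "s < 1" "\<alpha> = 2 * s" using assms by (auto simp: s_def)
  obtain k where k: "nat \<bar>n\<bar> = Suc k" using assms(3) by (cases "nat \<bar>n\<bar>") auto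
  have "binom_coeff s (Suc k) < 0" using s by (intro binom_coeff_neg)
  then have "pochhammer (- s) (Suc k) < 0" by (simp add: binom_coeff_def divide_less_0_iff del: fact_Suc)
  then have "exact_coeff \<alpha> (int (Suc k)) < 0"
    unfolding s(3) exact_coeff_pochhammer[OF s(1,2)] using s
    by (intro divide_neg_pos mult_neg_pos mult_pos_pos Gamma_real_pos) auto
  then show ?thesis by (simp flip: k)
qed

text \<open>Convergent sequences are bounded. Applied to \<open>X\<close> and to
  \<open>inverse X\<close>, this gives bounds for every \<open>n\<close>, not only
  eventually.\<close>

lemma bounded_between_of_tendsto_pos:
  fixes X :: "nat \<Rightarrow> real"
  assumes "X \<longlonglongrightarrow> L" "L \<noteq> 0" "\<And>n. X n > 0"
  obtains c C where "0 < c" "0 < C" "\<And>n. c \<le> X n" "\<And>n. X n \<le> C"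
proof -
  obtain C where C: "0 < C" "\<And>n. norm (X n) \<le> C"
    using convergent_imp_Bseq[OF convergentI[OF assms(1)]] by (elim BseqE) auto
  have "(\<lambda>n. inverse (X n)) \<longlonglongrightarrow> inverse L" using assms by (intro tendsto_inverse)
  then have "Bseq (\<lambda>n. inverse (X n))" by (intro convergent_imp_Bseq convergentI)
  then obtain D where D: "0 < D" "\<And>n. norm (inverse (X n)) \<le> D"
    by (elim BseqE) auto
  show ?thesis
  proof (rule that[of "inverse D" C])
    fix n
    have "0 < inverse (X n)" "inverse (X n) \<le> D" using D(2)[of n] assms(3)[of n] by auto
    then show "inverse D \<le> X n" using le_imp_inverse_le[of "inverse (X n)" D] by simp
    show "X n \<le> C" using C(2)[of n] assms(3)[of n] by simp
  qed (use C D in auto)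
qed

text \<open>The Pochhammer quotient in the coefficient is, up to a power of \<open>n\<close>, a
  quotient of two \<open>Gamma_series\<close>. Hence the coefficient times
  \<open>n powr (1 + \<alpha>)\<close> has a nonzero limit.\<close>

lemma exact_coeff_decay:
  assumes \<alpha>: "0 < \<alpha>" "\<alpha> < 2"
  obtains c C where "0 < c" "0 < C"
    "\<And>n. n \<noteq> 0 \<Longrightarrow> c * of_int \<bar>n\<bar> powr (- 1 - \<alpha>) \<le> - exact_coeff \<alpha> n"
    "\<And>n. n \<noteq> 0 \<Longrightarrow> - exact_coeff \<alpha> n \<le> C * of_int \<bar>n\<bar> powr (- 1 - \<alpha>)"
proof -
  define s where "s = \<alpha> / 2"
  have s: "0 < s" "s < 1" "\<alpha> = 2 * s" using assms by (auto simp: s_def)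
  \<comment> \<open>The index \<open>Suc n\<close> skips the positive central coefficient and
    matches \<open>pochhammer x (Suc n)\<close> in \<open>Gamma_series x n\<close>.\<close>
  define X where "X n = real (Suc n) powr (1 + \<alpha>) * (- exact_coeff \<alpha> (int (Suc n)))" for n
  define K where "K = Gamma (1 + 2 * s) / (Gamma (1 + s))\<^sup>2"
  have G: "Gamma (1 + s) \<noteq> 0" "Gamma (1 + 2 * s) \<noteq> 0"
    using s by (auto intro!: less_imp_neq[symmetric] Gamma_real_pos)
  have Gm: "Gamma (- s) \<noteq> 0"
  proof (rule Gamma_nonzero, rule notI)
    assume "- s \<in> \<int>\<^sub>\<le>\<^sub>0"
    then obtain m :: int where "- s = of_int m" by (elim nonpos_Ints_cases) auto
    then have "0 < - m" "- m < 1" using s by linarith+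
    then show False by simp
  qed
  \<comment> \<open>\<open>Gamma_series\<close> contributes powers of \<open>n\<close> and
    \<open>X\<close> powers of \<open>Suc n\<close>; the quotient of the two remains, with limit
    1.\<close>
  have X: "X n = - ((real (Suc n) / real n) powr (1 + \<alpha>) * K * (Gamma_series (1 + s) n / Gamma_series (- s) n))"
    if "n > 0" for n
  proof -
    have "pochhammer (1 + s) (Suc n) = Gamma (1 + s + real (Suc n)) / Gamma (1 + s)"
      using s by (intro pochhammer_Gamma) (auto simp: nonpos_Ints_def)
    then have "Gamma (real (Suc n) + 1 + s) = pochhammer (1 + s) (Suc n) * Gamma (1 + s)"
      using G by (simp add: add_ac)
    then have h: "exact_coeff \<alpha> (int (Suc n)) = pochhammer (- s) (Suc n) * K / pochhammer (1 + s) (Suc n)"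
      unfolding s(3) exact_coeff_pochhammer[OF s(1,2)] K_def by (simp add: power2_eq_square)
    have e: "exp (x * ln (real n)) = real n powr x" for x using that by (simp add: powr_def)
    have p: "real n powr (1 + s) / real n powr (- s) = real n powr (1 + \<alpha>)"
      by (simp add: powr_diff[symmetric] s(3) add.commute)
    have "Gamma_series (1 + s) n / Gamma_series (- s) n
        = (real n powr (1 + s) / real n powr (- s)) * (pochhammer (- s) (Suc n) / pochhammer (1 + s) (Suc n))"
      unfolding Gamma_series_def by (simp add: e e[of "- s", simplified])
    also have "\<dots> = real n powr (1 + \<alpha>) * (pochhammer (- s) (Suc n) / pochhammer (1 + s) (Suc n))"
      unfolding p ..
    finally show ?thesis
      using that unfolding X_def h by (simp add: powr_divide)
  qed
  have "(\<lambda>n. real (Suc n) / real n) \<longlonglongrightarrow> 1"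
    by (rule LIMSEQ_Suc_n_over_n)
  then have "(\<lambda>n. - ((real (Suc n) / real n) powr (1 + \<alpha>) * K * (Gamma_series (1 + s) n / Gamma_series (- s) n)))
      \<longlonglongrightarrow> - (1 powr (1 + \<alpha>) * K * (Gamma (1 + s) / Gamma (- s)))"
    using Gm by (intro tendsto_intros Gamma_series_LIMSEQ) auto
  then have "X \<longlonglongrightarrow> - (1 powr (1 + \<alpha>) * K * (Gamma (1 + s) / Gamma (- s)))"
    by (rule Lim_transform_eventually) (auto intro: eventually_mono[OF eventually_gt_at_top[of 0]] simp: X)
  moreover have "- (1 powr (1 + \<alpha>) * K * (Gamma (1 + s) / Gamma (- s))) \<noteq> 0"
    using G Gm by (simp add: K_def)
  moreover have "X n > 0" for n
    unfolding X_def using exact_coeff_neg[OF \<alpha>, of "int (Suc n)"] by (intro mult_pos_pos) auto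
  ultimately obtain c C where c: "0 < c" "0 < C" "\<And>n. c \<le> X n" "\<And>n. X n \<le> C"
    by (rule bounded_between_of_tendsto_pos) blast
  show ?thesis
  proof (rule that[OF c(1,2)])
    fix n :: int assume n: "n \<noteq> 0"
    obtain k where k: "nat \<bar>n\<bar> = Suc k" using n by (cases "nat \<bar>n\<bar>") auto
    have n': "\<bar>n\<bar> = int (Suc k)" using k by linarith
    have e: "exact_coeff \<alpha> n = exact_coeff \<alpha> (int (Suc k))" by (metis n' exact_coeff_abs)
    have "real (Suc k) powr (1 + \<alpha>) * real (Suc k) powr (- 1 - \<alpha>) = 1"
      by (simp add: powr_add[symmetric] del: of_nat_Suc)
    then have x: "- exact_coeff \<alpha> n = X k * of_int \<bar>n\<bar> powr (- 1 - \<alpha>)"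
      unfolding X_def n' e by (simp add: mult.assoc mult.commute del: of_nat_Suc) 
    show "c * of_int \<bar>n\<bar> powr (- 1 - \<alpha>) \<le> - exact_coeff \<alpha> n"
      "- exact_coeff \<alpha> n \<le> C * of_int \<bar>n\<bar> powr (- 1 - \<alpha>)"
      unfolding x by (intro mult_right_mono c; simp)+
  qed
qed

section \<open>The aliasing error\<close>

definition coeff_error :: "real \<Rightarrow> nat \<Rightarrow> int \<Rightarrow> real" where
  "coeff_error \<alpha> N n = exact_coeff \<alpha> n - fft_coeff \<alpha> N n"

text \<open>The subtracted \<open>\<bar>n\<bar>\<close> is at most half of
  \<open>2 * N * \<bar>k\<bar>\<close>. The product form of the bound allows a power of
  \<open>N\<close> to be factored out of the aliasing sum.\<close>

lemma alias_index_ge: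
  assumes "\<bar>n\<bar> \<le> int N" "k \<noteq> 0"
  shows "int N * \<bar>k\<bar> \<le> \<bar>n + 2 * int N * k\<bar>"
proof -
  have "int N * 1 \<le> int N * \<bar>k\<bar>" using assms by (intro mult_left_mono) auto
  moreover have "\<bar>2 * int N * k\<bar> = 2 * (int N * \<bar>k\<bar>)" by (simp add: abs_mult)
  ultimately show ?thesis using assms(1) by linarith
qed

context
  fixes \<alpha> :: real
  assumes \<alpha>: "0 < \<alpha>" "\<alpha> < 2"
begin

text \<open>The term \<open>k = 0\<close> of the aliasing sum is the exact coefficient
  itself.\<close>

lemma coeff_error_has_sum:
  assumes "N \<ge> 1"
  shows "((\<lambda>k. - exact_coeff \<alpha> (n + 2 * int N * k)) has_sum coeff_error \<alpha> N n) (UNIV - {0})"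
proof -
  have "((\<lambda>k. exact_coeff \<alpha> (n + 2 * int N * k)) has_sum (fft_coeff \<alpha> N n - exact_coeff \<alpha> n)) (UNIV - {0})"
    by (intro has_sum_Diff fft_coeff_aliasing \<alpha> assms) (auto simp: has_sum_finite_iff)
  then show ?thesis by (simp add: has_sum_uminus coeff_error_def)
qed

lemma exact_coeff_alias_neg:
  assumes "N \<ge> 1" "\<bar>n\<bar> \<le> int N" "k \<noteq> 0"
  shows "exact_coeff \<alpha> (n + 2 * int N * k) < 0"
proof (rule exact_coeff_neg[OF \<alpha>])
  have "0 < int N * \<bar>k\<bar>" using assms by simp
  then show "n + 2 * int N * k \<noteq> 0" using alias_index_ge[OF assms(2,3)] by linarith
qed

text \<open>All summands of the error are positive, so the one for \<open>k = 1\<close> alone is a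
  lower bound.\<close>

lemma coeff_error_ge:
  assumes "N \<ge> 1" "\<bar>n\<bar> \<le> int N"
  shows "- exact_coeff \<alpha> (n + 2 * int N) \<le> coeff_error \<alpha> N n"
proof -
  have "(\<Sum>k\<in>{1}. - exact_coeff \<alpha> (n + 2 * int N * k)) \<le> coeff_error \<alpha> N n"
    using exact_coeff_alias_neg[OF assms]
    by (intro finite_sum_le_has_sum[OF coeff_error_has_sum[OF assms(1)]]) (auto simp: less_imp_le)
  then show ?thesis by simp
qed

lemma coeff_error_pos:
  assumes "N \<ge> 1" "\<bar>n\<bar> \<le> int N"
  shows "coeff_error \<alpha> N n > 0"
  using coeff_error_ge[OF assms] exact_coeff_alias_neg[OF assms, of 1] by simp

text \<open>The Fourier series at frequency 0, where the symbol vanishes.\<close>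

lemma exact_coeff_has_sum_0: "(exact_coeff \<alpha> has_sum 0) UNIV"
  using exact_coeff_fourier[of "\<alpha> / 2" 0] \<alpha> by (simp add: stencil_symbol_def)

text \<open>Each of the \<open>2 * N + 1\<close> errors is of order
  \<open>N powr (- 1 - \<alpha>)\<close>: from below by the alias \<open>k = 1\<close>, from above
  by comparing the whole aliasing sum with a fixed convergent series scaled by that power.\<close>

lemma sum_coeff_error_bounds:
  obtains c C where "0 < c" "0 < C"
    "\<And>N. N \<ge> 1 \<Longrightarrow> c * real N powr (- \<alpha>) \<le> (\<Sum>n=-int N..int N. coeff_error \<alpha> N n)"
    "\<And>N. N \<ge> 1 \<Longrightarrow> (\<Sum>n=-int N..int N. coeff_error \<alpha> N n) \<le> C * real N powr (- \<alpha>)"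
proof -
  obtain c C where c: "0 < c" "0 < C"
    and lower: "\<And>n. n \<noteq> 0 \<Longrightarrow> c * of_int \<bar>n\<bar> powr (- 1 - \<alpha>) \<le> - exact_coeff \<alpha> n"
    and upper: "\<And>n. n \<noteq> 0 \<Longrightarrow> - exact_coeff \<alpha> n \<le> C * of_int \<bar>n\<bar> powr (- 1 - \<alpha>)"
    using exact_coeff_decay[OF \<alpha>] by blast
  \<comment> \<open>Since all coefficients sum to 0, \<open>E\<close> is also the sum of the negated
    noncentral ones, which is the convergent majorant for the upper bound.\<close>
  define E where "E = exact_coeff \<alpha> 0"
  have E: "E > 0" unfolding E_def by (rule exact_coeff_0_pos[OF \<alpha>(1)])
  have "(exact_coeff \<alpha> has_sum (0 - E)) (UNIV - {0})"
    by (intro has_sum_Diff exact_coeff_has_sum_0) (auto simp: has_sum_finite_iff E_def)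
  then have Esum: "((\<lambda>k. - exact_coeff \<alpha> k) has_sum E) (UNIV - {0})"
    by (simp add: has_sum_uminus)
  have pw: "real N powr (- \<alpha>) = real N * real N powr (- 1 - \<alpha>)" if "N \<ge> 1" for N
    using that powr_add[of "real N" 1 "- 1 - \<alpha>"] by simp
  show ?thesis
  proof (rule that[of "c * 3 powr (- 1 - \<alpha>)" "3 * (C / c * E)"])
    fix N :: nat assume N: "N \<ge> 1"
    let ?p = "real N powr (- 1 - \<alpha>)"
    have card: "card {- int N..int N} = 2 * N + 1" by simp
    have ge: "c * (3 powr (- 1 - \<alpha>) * ?p) \<le> coeff_error \<alpha> N n" if "n \<in> {- int N..int N}" for n
    proof -
      have n: "\<bar>n\<bar> \<le> int N" using that by auto
      \<comment> \<open>The alias index lies between \<open>N\<close> and \<open>3 * N\<close>; this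
        is the source of the factor \<open>3 powr (- 1 - \<alpha>)\<close>.\<close>
      have "\<bar>n + 2 * int N\<bar> \<le> 3 * int N" "\<bar>n + 2 * int N\<bar> > 0" using that N by auto
      then have "(3 * real N) powr (- 1 - \<alpha>) \<le> of_int \<bar>n + 2 * int N\<bar> powr (- 1 - \<alpha>)"
        using \<alpha> by (intro powr_mono2') linarith+
      then have "c * (3 * real N) powr (- 1 - \<alpha>) \<le> c * of_int \<bar>n + 2 * int N\<bar> powr (- 1 - \<alpha>)"
        using c by (intro mult_left_mono) auto
      also have "\<dots> \<le> - exact_coeff \<alpha> (n + 2 * int N)"
        using \<open>\<bar>n + 2 * int N\<bar> > 0\<close> by (intro lower) auto
      also have "\<dots> \<le> coeff_error \<alpha> N n" using coeff_error_ge[OF N n] .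
      finally show ?thesis by (simp add: powr_mult)
    qed
    have "c * 3 powr (- 1 - \<alpha>) * real N powr (- \<alpha>) = real N * (c * (3 powr (- 1 - \<alpha>) * ?p))"
      unfolding pw[OF N] by simp
    also have "\<dots> \<le> real (2 * N + 1) * (c * (3 powr (- 1 - \<alpha>) * ?p))"
      using c by (intro mult_right_mono) auto
    also have "\<dots> \<le> (\<Sum>n=-int N..int N. coeff_error \<alpha> N n)"
      using sum_bounded_below[of "{- int N..int N}", OF ge] unfolding card by simp
    finally show "c * 3 powr (- 1 - \<alpha>) * real N powr (- \<alpha>) \<le> (\<Sum>n=-int N..int N. coeff_error \<alpha> N n)" .
    have le: "coeff_error \<alpha> N n \<le> C / c * E * ?p" if "n \<in> {- int N..int N}" for n
    proof -
      have n: "\<bar>n\<bar> \<le> int N" using that by auto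
      have "((\<lambda>k. C / c * ?p * - exact_coeff \<alpha> k) has_sum (C / c * ?p * E)) (UNIV - {0})"
        by (intro has_sum_cmult_right Esum)
      then have "coeff_error \<alpha> N n \<le> C / c * ?p * E"
      proof (rule has_sum_mono[OF coeff_error_has_sum[OF N]])
        fix k :: int assume "k \<in> UNIV - {0}"
        then have k: "k \<noteq> 0" by simp
        have "of_int \<bar>n + 2 * int N * k\<bar> powr (- 1 - \<alpha>) \<le> (real N * of_int \<bar>k\<bar>) powr (- 1 - \<alpha>)"
        proof (rule powr_mono2')
          have "of_int (int N * \<bar>k\<bar>) \<le> (of_int \<bar>n + 2 * int N * k\<bar> :: real)"
            using alias_index_ge[OF n k] by (simp only: of_int_le_iff)
          then show "real N * of_int \<bar>k\<bar> \<le> of_int \<bar>n + 2 * int N * k\<bar>" by simp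
        qed (use \<alpha> N k in auto)
        also have "\<dots> = ?p * of_int \<bar>k\<bar> powr (- 1 - \<alpha>)"
          by (simp add: powr_mult)
        \<comment> \<open>The lower decay bound is read backwards: the power of
          \<open>\<bar>k\<bar>\<close> is replaced by a coefficient, whose sum is known.\<close>
        also have "\<dots> \<le> ?p * (- exact_coeff \<alpha> k / c)"
          using lower[OF k] c by (intro mult_left_mono) (simp_all add: field_simps)
        finally have "C * of_int \<bar>n + 2 * int N * k\<bar> powr (- 1 - \<alpha>) \<le> C * (?p * (- exact_coeff \<alpha> k / c))"
          using c by (intro mult_left_mono) auto
        moreover have "- exact_coeff \<alpha> (n + 2 * int N * k) \<le> C * of_int \<bar>n + 2 * int N * k\<bar> powr (- 1 - \<alpha>)"
          using exact_coeff_alias_neg[OF N n k] exact_coeff_0_pos[OF \<alpha>(1)] by (intro upper) auto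
        ultimately show "- exact_coeff \<alpha> (n + 2 * int N * k) \<le> C / c * ?p * - exact_coeff \<alpha> k"
          by (simp add: mult_ac)
      qed
      then show ?thesis by (simp add: mult_ac)
    qed
    have "(\<Sum>n=-int N..int N. coeff_error \<alpha> N n) \<le> real (2 * N + 1) * (C / c * E * ?p)"
      using sum_bounded_above[of "{- int N..int N}", OF le] unfolding card by simp
    also have "\<dots> \<le> real (3 * N) * (C / c * E * ?p)"
      using c E N by (intro mult_right_mono) auto
    also have "\<dots> = 3 * (C / c * E) * real N powr (- \<alpha>)"
      unfolding pw[OF N] by simp
    finally show "(\<Sum>n=-int N..int N. coeff_error \<alpha> N n) \<le> 3 * (C / c * E) * real N powr (- \<alpha>)" .
  qed (use c E in auto)
qed

text \<open>As the full sum is 0, the truncated sum is the negated tail, whose coefficients are all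
  negative; the one at \<open>N + 1\<close> makes the inequality strict.\<close>

lemma sum_exact_coeff_pos: "(\<Sum>n=-int N..int N. exact_coeff \<alpha> n) > 0"
proof -
  have "(exact_coeff \<alpha> has_sum (0 - (\<Sum>n=-int N..int N. exact_coeff \<alpha> n))) (UNIV - {- int N..int N})"
    by (intro has_sum_Diff exact_coeff_has_sum_0) auto
  then have "((\<lambda>n. - exact_coeff \<alpha> n) has_sum (\<Sum>n=-int N..int N. exact_coeff \<alpha> n)) (UNIV - {- int N..int N})"
    by (simp add: has_sum_uminus)
  then have "(\<Sum>n\<in>{int N + 1}. - exact_coeff \<alpha> n) \<le> (\<Sum>n=-int N..int N. exact_coeff \<alpha> n)"
    by (rule finite_sum_le_has_sum) (use exact_coeff_neg[OF \<alpha>] in \<open>force simp: less_imp_le\<close>)+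
  moreover have "exact_coeff \<alpha> (int N + 1) < 0" by (intro exact_coeff_neg \<alpha>) auto
  ultimately show ?thesis by simp
qed

text \<open>
  The trapezoidal coefficients over one period sum to the symbol at frequency 0, which vanishes.
  The stencil has one term more than a period, and this term is negative.
\<close>

lemma sum_fft_coeff_neg:
  assumes N: "N \<ge> 1"
  shows "(\<Sum>n=-int N..int N. fft_coeff \<alpha> N n) < 0"
proof -
  \<comment> \<open>Division with remainder, offset by \<open>N\<close>, writes every integer
    uniquely as \<open>n + 2 * N * k\<close> with \<open>n\<close> in the half-open period.\<close>
  have "((\<lambda>(n, k). exact_coeff \<alpha> (n + 2 * int N * k)) has_sum 0) ({- int N..<int N} \<times> UNIV)
     \<longleftrightarrow> (exact_coeff \<alpha> has_sum 0) UNIV"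
  proof (rule has_sum_reindex_bij_witness[where j = "\<lambda>(n, k). n + 2 * int N * k"
        and i = "\<lambda>m. ((m + int N) mod (2 * int N) - int N, (m + int N) div (2 * int N))"])
    fix x assume "x \<in> {- int N..<int N} \<times> (UNIV :: int set)"
    then obtain n k where x: "x = (n, k)" "- int N \<le> n" "n < int N" by auto
    have e: "n + 2 * int N * k + int N = n + int N + 2 * int N * k" by simp
    show "(((case x of (n, k) \<Rightarrow> n + 2 * int N * k) + int N) mod (2 * int N) - int N,
        ((case x of (n, k) \<Rightarrow> n + 2 * int N * k) + int N) div (2 * int N)) = x"
      unfolding x prod.case e
      using x N by auto
  next
    fix m :: int
    have "(m + int N) mod (2 * int N) + 2 * int N * ((m + int N) div (2 * int N)) = m + int N"
      by (rule mod_mult_div_eq)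
    then show "(case ((m + int N) mod (2 * int N) - int N, (m + int N) div (2 * int N)) of
        (n, k) \<Rightarrow> n + 2 * int N * k) = m"
      unfolding prod.case by linarith
    show "((m + int N) mod (2 * int N) - int N, (m + int N) div (2 * int N)) \<in> {- int N..<int N} \<times> UNIV"
      using N pos_mod_bound[of "2 * int N" "m + int N"] pos_mod_sign[of "2 * int N" "m + int N"] by auto
  qed auto
  with exact_coeff_has_sum_0
  have "((\<lambda>(n, k). exact_coeff \<alpha> (n + 2 * int N * k)) has_sum 0) ({- int N..<int N} \<times> UNIV)" by simp
  then have "(fft_coeff \<alpha> N has_sum 0) {- int N..<int N}"
    by (rule has_sum_SigmaD) (use fft_coeff_aliasing[OF \<alpha> N] in simp)
  then have period: "(\<Sum>n\<in>{- int N..<int N}. fft_coeff \<alpha> N n) = 0"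
    by (simp add: has_sum_finite_iff)
  have neg: "exact_coeff \<alpha> (int N + 2 * int N * k) < 0" for k
  proof (rule exact_coeff_neg[OF \<alpha>])
    \<comment> \<open>The alias index at the end point \<open>N\<close> is \<open>N\<close> times an
      odd number, so not even \<open>k = 0\<close> or \<open>k = -1\<close> gives the central
      coefficient.\<close>
    have "int N * (1 + 2 * k) \<noteq> 0" using N by (simp, presburger)
    then show "int N + 2 * int N * k \<noteq> 0" by (simp add: algebra_simps)
  qed
  have "((\<lambda>k. - exact_coeff \<alpha> (int N + 2 * int N * k)) has_sum - fft_coeff \<alpha> N (int N)) UNIV"
    using fft_coeff_aliasing[OF \<alpha> N, of "int N"] by (simp add: has_sum_uminus)
  then have "(\<Sum>k\<in>{0}. - exact_coeff \<alpha> (int N + 2 * int N * k)) \<le> - fft_coeff \<alpha> N (int N)"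
    by (rule finite_sum_le_has_sum) (auto intro!: less_imp_le neg)
  then have "fft_coeff \<alpha> N (int N) < 0" using neg[of 0] by simp
  moreover have "{- int N..int N} = insert (int N) {- int N..<int N}" by auto
  ultimately show ?thesis using period by simp
qed

end

section \<open>Scaled stencils\<close>

lemma dft_0: "dft N s 0 = of_real (\<Sum>n=-int N..int N. s n)"
  by (simp add: dft_def)

lemma dft_diff: "dft N s j - dft N t j = dft N (\<lambda>n. s n - t n) j"
  by (simp add: dft_def sum_subtractf[symmetric] left_diff_distrib)

lemma scaled_diff: "scaled \<alpha> h s n - scaled \<alpha> h t n = scaled \<alpha> h (\<lambda>n. s n - t n) n"
  by (simp add: scaled_def right_diff_distrib)

lemma sum_scaled: "(\<Sum>n\<in>A. scaled \<alpha> h s n) = h powr (- \<alpha>) * (\<Sum>n\<in>A. s n)"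
  by (simp add: scaled_def sum_distrib_left)

text \<open>The scaling combines \<open>N powr (- \<alpha>)\<close> and
  \<open>h powr (- \<alpha>)\<close> into \<open>(N * h) powr (- \<alpha>)\<close>, which the bounds
  \<open>a\<close> and \<open>b\<close> on \<open>N * h\<close> confine.\<close>

lemma scaled_error_bounds:
  assumes \<alpha>: "0 < \<alpha>" "\<alpha> < 2" and ab: "0 < a" "a \<le> b"
  obtains c C where "0 < c" "0 < C"
    "\<And>N h. N \<ge> 1 \<Longrightarrow> 0 < h \<Longrightarrow> a \<le> real N * h \<Longrightarrow> real N * h \<le> b \<Longrightarrow>
      c \<le> (\<Sum>n=-int N..int N. scaled \<alpha> h (coeff_error \<alpha> N) n)"
    "\<And>N h. N \<ge> 1 \<Longrightarrow> 0 < h \<Longrightarrow> a \<le> real N * h \<Longrightarrow> real N * h \<le> b \<Longrightarrow>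
      (\<Sum>n=-int N..int N. scaled \<alpha> h (coeff_error \<alpha> N) n) \<le> C"
proof -
  obtain c C where c: "0 < c" "0 < C"
    and l: "\<And>N. N \<ge> 1 \<Longrightarrow> c * real N powr (- \<alpha>) \<le> (\<Sum>n=-int N..int N. coeff_error \<alpha> N n)"
    and u: "\<And>N. N \<ge> 1 \<Longrightarrow> (\<Sum>n=-int N..int N. coeff_error \<alpha> N n) \<le> C * real N powr (- \<alpha>)"
    using sum_coeff_error_bounds[OF \<alpha>] by blast
  show ?thesis
  proof (rule that[of "c * b powr (- \<alpha>)" "C * a powr (- \<alpha>)"])
    fix N :: nat and h :: real
    assume N: "N \<ge> 1" and h: "0 < h" and Nh: "a \<le> real N * h" "real N * h \<le> b"
    have e: "(real N * h) powr (- \<alpha>) = h powr (- \<alpha>) * real N powr (- \<alpha>)"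
      using h by (simp add: powr_mult)
    have "b powr (- \<alpha>) \<le> (real N * h) powr (- \<alpha>)" "(real N * h) powr (- \<alpha>) \<le> a powr (- \<alpha>)"
      using \<alpha> ab Nh N h by (intro powr_mono2'; simp)+
    then have "c * b powr (- \<alpha>) \<le> c * (real N * h) powr (- \<alpha>)" "C * (real N * h) powr (- \<alpha>) \<le> C * a powr (- \<alpha>)"
      using c by (intro mult_left_mono; simp)+
    moreover have "h powr (- \<alpha>) * (c * real N powr (- \<alpha>)) \<le> h powr (- \<alpha>) * (\<Sum>n=-int N..int N. coeff_error \<alpha> N n)"
      "h powr (- \<alpha>) * (\<Sum>n=-int N..int N. coeff_error \<alpha> N n) \<le> h powr (- \<alpha>) * (C * real N powr (- \<alpha>))"
      using l[OF N] u[OF N] by (intro mult_left_mono; simp)+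
    ultimately show "c * b powr (- \<alpha>) \<le> (\<Sum>n=-int N..int N. scaled \<alpha> h (coeff_error \<alpha> N) n)"
      "(\<Sum>n=-int N..int N. scaled \<alpha> h (coeff_error \<alpha> N) n) \<le> C * a powr (- \<alpha>)"
      unfolding sum_scaled e by (simp_all add: mult_ac)
  qed (use c ab in auto)
qed

section \<open>Periodic convolution equations\<close>

lemma sum_periodic_shift:
  fixes u :: "int \<Rightarrow> 'a :: comm_ring_1"
  assumes "\<And>i. u (i + (2 * int N + 1)) = u i"
  shows "(\<Sum>i=-int N..int N. u (i + m)) = (\<Sum>i=-int N..int N. u i)"
proof -
  have step: "(\<Sum>i=-int N..int N. u (i + (m + 1))) = (\<Sum>i=-int N..int N. u (i + m))" for m
  proof -
    have "(\<Sum>i=-int N..int N. u (i + (m + 1))) = (\<Sum>i=-int N+1..int N+1. u (i + m))"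
      by (rule sum.reindex_bij_witness[of _ "\<lambda>i. i - 1" "\<lambda>i. i + 1"]) (auto simp: add_ac)
    also have "\<dots> + u (- int N + m) = (\<Sum>i\<in>insert (- int N) {-int N+1..int N+1}. u (i + m))"
      by simp
    also have "insert (- int N) {-int N+1..int N+1} = insert (int N + 1) {-int N..int N}" by auto
    also have "(\<Sum>i\<in>insert (int N + 1) {-int N..int N}. u (i + m)) = u (int N + 1 + m) + (\<Sum>i=-int N..int N. u (i + m))"
      by simp
    also have "u (int N + 1 + m) = u (- int N + m)"
      using assms[of "- int N + m"] by (simp add: algebra_simps)
    finally show ?thesis by (simp add: add.commute)
  qed
  show ?thesis
  proof (induction m rule: int_induct[where k = 0])
    case (step2 i)
    then show ?case using step[of "i - 1"] by simp
  qed (simp_all add: step)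
qed

text \<open>The convolution theorem at frequency 0: averaging over a period multiplies the mean by
  the eigenvalue of the constant grid functions.\<close>

lemma grid_mean_stencil_solution:
  assumes "stencil_solution N s f u"
  shows "grid_mean N f = (\<Sum>n=-int N..int N. s n) * grid_mean N u"
proof -
  have per: "u (i + (2 * int N + 1)) = u i" and eq: "(\<Sum>n=-int N..int N. s n * u (i - n)) = f i" for i
    using assms by (auto simp: stencil_solution_def)
  have "(\<Sum>i=-int N..int N. f i) = (\<Sum>n=-int N..int N. \<Sum>i=-int N..int N. s n * u (i + - n))"
    unfolding eq[symmetric] by (subst sum.swap) simp
  also have "\<dots> = (\<Sum>n=-int N..int N. s n) * (\<Sum>i=-int N..int N. u i)"
    unfolding sum_distrib_left[symmetric] sum_periodic_shift[where u = u, OF per] by (simp add: sum_distrib_right)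
  finally show ?thesis by (simp add: grid_mean_def)
qed

text \<open>Constants are eigenvectors of the convolution. This ensures that the claim about
  solutions is not vacuous.\<close>

lemma stencil_solution_const:
  assumes "(\<Sum>n=-int N..int N. s n) \<noteq> 0"
  shows "stencil_solution N s (\<lambda>_. 1) (\<lambda>_. 1 / (\<Sum>n=-int N..int N. s n))"
  using assms by (simp add: stencil_solution_def sum_divide_distrib[symmetric])

lemma abs_grid_mean_le:
  "\<bar>grid_mean N u\<bar> \<le> Max ((\<lambda>i. \<bar>u i\<bar>) ` {- int N..int N})"
proof -
  let ?M = "Max ((\<lambda>i. \<bar>u i\<bar>) ` {- int N..int N})"
  have "\<bar>\<Sum>n=-int N..int N. u n\<bar> \<le> (\<Sum>n=-int N..int N. \<bar>u n\<bar>)" by (rule sum_abs)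
  also have "\<dots> \<le> of_nat (card {-int N..int N}) * ?M"
    by (intro sum_bounded_above Max_ge) auto
  finally show ?thesis by (simp add: grid_mean_def abs_divide divide_le_eq mult.commute add_ac)
qed

section \<open>Uniform bounds and non-convergence\<close>

lemma not_tendsto_0_of_lower_bound:
  fixes X :: "nat \<Rightarrow> real"
  assumes "0 < c" "\<And>m. c \<le> X m"
  shows "\<not> X \<longlonglongrightarrow> 0"
  using assms LIMSEQ_le_const[of X 0 c] by fastforce

lemma bigtheta_1_of_bounds:
  fixes f :: "nat \<Rightarrow> 'a :: real_normed_field"
  assumes "0 < c" "0 < C" "\<And>m. c \<le> norm (f m)" "\<And>m. norm (f m) \<le> C"
  shows "f \<in> \<Theta>(\<lambda>_. 1)"
  using assms by (intro bigthetaI'[of c C]) auto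

text \<open>The means of the two solutions are \<open>grid_mean N f\<close> divided by
  \<open>S\<close> and by \<open>T\<close>, hence of opposite sign. Their distance is at least the
  modulus of the first, and the maximum norm dominates the difference of means.\<close>

lemma solutions_differ:
  assumes S: "0 < S" "S \<le> C" "T < 0" and \<delta>: "0 < \<delta>" "\<delta> \<le> \<bar>grid_mean N f\<bar>"
    and u: "stencil_solution N s f u" "(\<Sum>n=-int N..int N. s n) = S"
    and v: "stencil_solution N t f v" "(\<Sum>n=-int N..int N. t n) = T"
  shows "\<delta> / C \<le> Max ((\<lambda>i. \<bar>u i - v i\<bar>) ` {- int N..int N})"
proof -
  let ?U = "grid_mean N u" and ?V = "grid_mean N v" and ?F = "grid_mean N f"
  have U: "?U = ?F / S" and V: "?V = ?F / T"
    using grid_mean_stencil_solution[OF u(1)] grid_mean_stencil_solution[OF v(1)] u(2) v(2) S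
    by (simp_all add: field_simps)
  have "\<delta> / C \<le> \<bar>?F\<bar> / S" using S \<delta> by (intro frac_le) auto
  also have "\<dots> \<le> \<bar>?F\<bar> * (1 / S - 1 / T)"
  proof -
    have "1 / T \<le> 0" using S by simp
    then have "\<bar>?F\<bar> * (1 / S) \<le> \<bar>?F\<bar> * (1 / S - 1 / T)" by (intro mult_left_mono) auto
    then show ?thesis by simp
  qed
  also have "1 / S - 1 / T = \<bar>1 / S - 1 / T\<bar>"
  proof -
    have "1 / T \<le> 0" "0 \<le> 1 / S" using S by simp_all
    then show ?thesis by linarith
  qed
  also have "\<bar>?F\<bar> * \<bar>1 / S - 1 / T\<bar> = \<bar>?U - ?V\<bar>"
    unfolding U V by (simp add: abs_mult[symmetric] right_diff_distrib)
  also have "?U - ?V = grid_mean N (\<lambda>i. u i - v i)"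
    by (simp add: grid_mean_def sum_subtractf diff_divide_distrib)
  also have "\<bar>\<dots>\<bar> \<le> Max ((\<lambda>i. \<bar>u i - v i\<bar>) ` {- int N..int N})"
    by (rule abs_grid_mean_le)
  finally show ?thesis .
qed

section \<open>Aliasing formula, error at the origin, and failure of convergence\<close>

theorem mainTheorem6:
  fixes \<alpha> a b :: real
  assumes alpha: "0 < \<alpha>" "\<alpha> < 2"
    and ab: "0 < a" "a \<le> b"
  shows
    "(\<forall>N::nat. \<forall>n::int. 1 \<le> N \<longrightarrow> - int N \<le> n \<longrightarrow> n \<le> int N \<longrightarrow>
        (\<lambda>k::int. exact_coeff \<alpha> (n + 2 * int N * k)) summable_on (UNIV - {0}) \<and>
        exact_coeff \<alpha> n - fft_coeff \<alpha> N n
          = - (\<Sum>\<^sub>\<infinity>k\<in>UNIV - {0::int}. exact_coeff \<alpha> (n + 2 * int N * k)) \<and>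
        - (\<Sum>\<^sub>\<infinity>k\<in>UNIV - {0::int}. exact_coeff \<alpha> (n + 2 * int N * k))
          = (\<Sum>\<^sub>\<infinity>k\<in>UNIV - {0::int}.
               (-1) powi (n + 1) * gamma_binomial \<alpha> (\<alpha> / 2 + of_int n + 2 * real N * of_int k)) \<and>
        exact_coeff \<alpha> n - fft_coeff \<alpha> N n > 0)
     \<and>
     (\<forall>N::nat. 1 \<le> N \<longrightarrow>
        dft N (\<lambda>n. exact_coeff \<alpha> n - fft_coeff \<alpha> N n) 0
          = of_real (\<Sum>n = - int N..int N. exact_coeff \<alpha> n - fft_coeff \<alpha> N n))
     \<and>
     (\<exists>C>0.
        (\<forall>(N::nat) (h::real). 1 \<le> N \<longrightarrow> 0 < h \<longrightarrow> a \<le> real N * h \<longrightarrow> real N * h \<le> b \<longrightarrow>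
           dft N (scaled \<alpha> h (\<lambda>n. exact_coeff \<alpha> n - fft_coeff \<alpha> N n)) 0
             = of_real (\<Sum>n = - int N..int N. scaled \<alpha> h (\<lambda>n. exact_coeff \<alpha> n - fft_coeff \<alpha> N n) n) \<and>
           (\<Sum>n = - int N..int N. scaled \<alpha> h (\<lambda>n. exact_coeff \<alpha> n - fft_coeff \<alpha> N n) n)
             > 2 * real N * h * C) \<and>
        (\<forall>(N :: nat \<Rightarrow> nat) (h :: nat \<Rightarrow> real).
           (\<forall>m. 1 \<le> N m \<and> 0 < h m \<and> a \<le> real (N m) * h m \<and> real (N m) * h m \<le> b) \<longrightarrow>
           h \<longlonglongrightarrow> 0 \<longrightarrow>
           (\<lambda>m. 2 * real (N m) * h m * C) \<in> \<Theta>(\<lambda>_. 1)))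
     \<and>
     (\<forall>(N :: nat \<Rightarrow> nat) (h :: nat \<Rightarrow> real).
        (\<forall>m. 1 \<le> N m \<and> 0 < h m \<and> a \<le> real (N m) * h m \<and> real (N m) * h m \<le> b) \<longrightarrow>
        h \<longlonglongrightarrow> 0 \<longrightarrow>
        (\<lambda>m. dft (N m) (scaled \<alpha> (h m) (\<lambda>n. exact_coeff \<alpha> n - fft_coeff \<alpha> (N m) n)) 0)
          \<in> \<Theta>(\<lambda>_. 1) \<and>
        \<not> (\<lambda>m. Max ((\<lambda>j. cmod (dft (N m) (scaled \<alpha> (h m) (exact_coeff \<alpha>)) j
                               - dft (N m) (scaled \<alpha> (h m) (fft_coeff \<alpha> (N m))) j))
                      ` {- int (N m)..int (N m)})) \<longlonglongrightarrow> 0 \<and>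
        (\<forall>m. \<exists>u v.
           stencil_solution (N m) (scaled \<alpha> (h m) (exact_coeff \<alpha>)) (\<lambda>_. 1) u \<and>
           stencil_solution (N m) (scaled \<alpha> (h m) (fft_coeff \<alpha> (N m))) (\<lambda>_. 1) v) \<and>
        (\<forall>(\<delta> :: real) (f :: nat \<Rightarrow> int \<Rightarrow> real) (u :: nat \<Rightarrow> int \<Rightarrow> real) (v :: nat \<Rightarrow> int \<Rightarrow> real).
           0 < \<delta> \<longrightarrow>
           (\<forall>m. \<delta> \<le> \<bar>grid_mean (N m) (f m)\<bar>) \<longrightarrow>
           (\<forall>m. stencil_solution (N m) (scaled \<alpha> (h m) (exact_coeff \<alpha>)) (f m) (u m)) \<longrightarrow>
           (\<forall>m. stencil_solution (N m) (scaled \<alpha> (h m) (fft_coeff \<alpha> (N m))) (f m) (v m)) \<longrightarrow>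
           \<not> (\<lambda>m. Max ((\<lambda>i. \<bar>u m i - v m i\<bar>) ` {- int (N m)..int (N m)})) \<longlonglongrightarrow> 0))"
proof (unfold coeff_error_def[symmetric], intro conjI)
  have b: "0 < b" using ab by linarith
  obtain c C where c: "0 < c" "0 < C"
    and lower: "\<And>N h. N \<ge> 1 \<Longrightarrow> 0 < h \<Longrightarrow> a \<le> real N * h \<Longrightarrow> real N * h \<le> b \<Longrightarrow>
      c \<le> (\<Sum>n=-int N..int N. scaled \<alpha> h (coeff_error \<alpha> N) n)"
    and upper: "\<And>N h. N \<ge> 1 \<Longrightarrow> 0 < h \<Longrightarrow> a \<le> real N * h \<Longrightarrow> real N * h \<le> b \<Longrightarrow>
      (\<Sum>n=-int N..int N. scaled \<alpha> h (coeff_error \<alpha> N) n) \<le> C"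
    using scaled_error_bounds[OF alpha ab] by blast

  show "\<forall>N::nat. \<forall>n::int. 1 \<le> N \<longrightarrow> - int N \<le> n \<longrightarrow> n \<le> int N \<longrightarrow>
        (\<lambda>k::int. exact_coeff \<alpha> (n + 2 * int N * k)) summable_on (UNIV - {0}) \<and>
        coeff_error \<alpha> N n
          = - (\<Sum>\<^sub>\<infinity>k\<in>UNIV - {0::int}. exact_coeff \<alpha> (n + 2 * int N * k)) \<and>
        - (\<Sum>\<^sub>\<infinity>k\<in>UNIV - {0::int}. exact_coeff \<alpha> (n + 2 * int N * k))
          = (\<Sum>\<^sub>\<infinity>k\<in>UNIV - {0::int}.
               (-1) powi (n + 1) * gamma_binomial \<alpha> (\<alpha> / 2 + of_int n + 2 * real N * of_int k)) \<and>
        coeff_error \<alpha> N n > 0"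
  proof (intro allI impI conjI)
    fix N :: nat and n :: int
    assume N: "1 \<le> N" and n: "- int N \<le> n" "n \<le> int N"
    have "((\<lambda>k. exact_coeff \<alpha> (n + 2 * int N * k)) has_sum - coeff_error \<alpha> N n) (UNIV - {0})"
      using coeff_error_has_sum[OF alpha N, of n] by (simp add: has_sum_uminus)
    then show "(\<lambda>k::int. exact_coeff \<alpha> (n + 2 * int N * k)) summable_on (UNIV - {0})"
      and "coeff_error \<alpha> N n = - (\<Sum>\<^sub>\<infinity>k\<in>UNIV - {0::int}. exact_coeff \<alpha> (n + 2 * int N * k))"
      by (auto simp: summable_on_def infsumI)
    have "- exact_coeff \<alpha> (n + 2 * int N * k)
        = (-1) powi (n + 1) * gamma_binomial \<alpha> (\<alpha> / 2 + of_int n + 2 * real N * of_int k)" for k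
      by (simp add: exact_coeff_def power_int_minus_left add.assoc)
    then show "- (\<Sum>\<^sub>\<infinity>k\<in>UNIV - {0::int}. exact_coeff \<alpha> (n + 2 * int N * k))
          = (\<Sum>\<^sub>\<infinity>k\<in>UNIV - {0::int}.
               (-1) powi (n + 1) * gamma_binomial \<alpha> (\<alpha> / 2 + of_int n + 2 * real N * of_int k))"
      by (simp flip: infsum_uminus)
    show "coeff_error \<alpha> N n > 0" using n by (intro coeff_error_pos alpha N) auto
  qed

  show "\<forall>N::nat. 1 \<le> N \<longrightarrow> dft N (\<lambda>n. coeff_error \<alpha> N n) 0 = of_real (\<Sum>n = - int N..int N. coeff_error \<alpha> N n)"
    by (simp add: dft_0)

  show "\<exists>C>0.
        (\<forall>(N::nat) (h::real). 1 \<le> N \<longrightarrow> 0 < h \<longrightarrow> a \<le> real N * h \<longrightarrow> real N * h \<le> b \<longrightarrow>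
           dft N (scaled \<alpha> h (\<lambda>n. coeff_error \<alpha> N n)) 0
             = of_real (\<Sum>n = - int N..int N. scaled \<alpha> h (\<lambda>n. coeff_error \<alpha> N n) n) \<and>
           (\<Sum>n = - int N..int N. scaled \<alpha> h (\<lambda>n. coeff_error \<alpha> N n) n) > 2 * real N * h * C) \<and>
        (\<forall>(N :: nat \<Rightarrow> nat) (h :: nat \<Rightarrow> real).
           (\<forall>m. 1 \<le> N m \<and> 0 < h m \<and> a \<le> real (N m) * h m \<and> real (N m) * h m \<le> b) \<longrightarrow>
           h \<longlonglongrightarrow> 0 \<longrightarrow>
           (\<lambda>m. 2 * real (N m) * h m * C) \<in> \<Theta>(\<lambda>_. 1))"
  \<comment> \<open>With this constant, \<open>2 * N * h * C\<close> is at most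
    \<open>c / 2\<close>, strictly below the uniform lower bound \<open>c\<close>.\<close>
  proof (intro exI[of _ "c / (4 * b)"] conjI allI impI)
    show "0 < c / (4 * b)" using c b by simp
  next
    fix N :: nat and h :: real
    assume *: "1 \<le> N" "0 < h" "a \<le> real N * h" "real N * h \<le> b"
    show "dft N (scaled \<alpha> h (coeff_error \<alpha> N)) 0
        = of_real (\<Sum>n = - int N..int N. scaled \<alpha> h (coeff_error \<alpha> N) n)"
      by (rule dft_0)
    have "2 * (real N * h) * (c / (4 * b)) \<le> 2 * b * (c / (4 * b))"
      using * c b by (intro mult_right_mono mult_left_mono) auto
    also have "\<dots> < c" using b c by simp
    also have "\<dots> \<le> (\<Sum>n = - int N..int N. scaled \<alpha> h (coeff_error \<alpha> N) n)" using * by (rule lower)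
    finally show "2 * real N * h * (c / (4 * b)) < (\<Sum>n = - int N..int N. scaled \<alpha> h (coeff_error \<alpha> N) n)"
      by (simp add: mult.assoc)
  next
    fix N :: "nat \<Rightarrow> nat" and h :: "nat \<Rightarrow> real"
    assume *: "\<forall>m. 1 \<le> N m \<and> 0 < h m \<and> a \<le> real (N m) * h m \<and> real (N m) * h m \<le> b"
    show "(\<lambda>m. 2 * real (N m) * h m * (c / (4 * b))) \<in> \<Theta>(\<lambda>_. 1)"
    proof (rule bigtheta_1_of_bounds)
      fix m
      have Nh: "a \<le> real (N m) * h m" "real (N m) * h m \<le> b" "0 < real (N m) * h m"
        using * ab(1) by (auto intro: less_le_trans[OF ab(1)])
      have e: "norm (2 * real (N m) * h m * (c / (4 * b))) = real (N m) * h m * (2 * (c / (4 * b)))"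
        using Nh(3) c b *[rule_format, of m] by (simp add: abs_mult)
      show "a * (2 * (c / (4 * b))) \<le> norm (2 * real (N m) * h m * (c / (4 * b)))"
        "norm (2 * real (N m) * h m * (c / (4 * b))) \<le> b * (2 * (c / (4 * b)))"
        unfolding e using Nh c b by (intro mult_right_mono; simp)+
    qed (use ab b c in auto)
  qed

  show "\<forall>(N :: nat \<Rightarrow> nat) (h :: nat \<Rightarrow> real).
        (\<forall>m. 1 \<le> N m \<and> 0 < h m \<and> a \<le> real (N m) * h m \<and> real (N m) * h m \<le> b) \<longrightarrow>
        h \<longlonglongrightarrow> 0 \<longrightarrow>
        (\<lambda>m. dft (N m) (scaled \<alpha> (h m) (\<lambda>n. coeff_error \<alpha> (N m) n)) 0)
          \<in> \<Theta>(\<lambda>_. 1) \<and>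
        \<not> (\<lambda>m. Max ((\<lambda>j. cmod (dft (N m) (scaled \<alpha> (h m) (exact_coeff \<alpha>)) j
                               - dft (N m) (scaled \<alpha> (h m) (fft_coeff \<alpha> (N m))) j))
                      ` {- int (N m)..int (N m)})) \<longlonglongrightarrow> 0 \<and>
        (\<forall>m. \<exists>u v.
           stencil_solution (N m) (scaled \<alpha> (h m) (exact_coeff \<alpha>)) (\<lambda>_. 1) u \<and>
           stencil_solution (N m) (scaled \<alpha> (h m) (fft_coeff \<alpha> (N m))) (\<lambda>_. 1) v) \<and>
        (\<forall>(\<delta> :: real) (f :: nat \<Rightarrow> int \<Rightarrow> real) (u :: nat \<Rightarrow> int \<Rightarrow> real) (v :: nat \<Rightarrow> int \<Rightarrow> real).
           0 < \<delta> \<longrightarrow>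
           (\<forall>m. \<delta> \<le> \<bar>grid_mean (N m) (f m)\<bar>) \<longrightarrow>
           (\<forall>m. stencil_solution (N m) (scaled \<alpha> (h m) (exact_coeff \<alpha>)) (f m) (u m)) \<longrightarrow>
           (\<forall>m. stencil_solution (N m) (scaled \<alpha> (h m) (fft_coeff \<alpha> (N m))) (f m) (v m)) \<longrightarrow>
           \<not> (\<lambda>m. Max ((\<lambda>i. \<bar>u m i - v m i\<bar>) ` {- int (N m)..int (N m)})) \<longlonglongrightarrow> 0)"
  proof (intro allI impI)
    fix N :: "nat \<Rightarrow> nat" and h :: "nat \<Rightarrow> real"
    assume "\<forall>m. 1 \<le> N m \<and> 0 < h m \<and> a \<le> real (N m) * h m \<and> real (N m) * h m \<le> b"
    then have Nh: "1 \<le> N m" "0 < h m" "a \<le> real (N m) * h m" "real (N m) * h m \<le> b" for m by auto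
    \<comment> \<open>\<open>S\<close>, \<open>T\<close> and \<open>R\<close> are the values at
      frequency 0 for the scaled exact stencil, the scaled trapezoidal stencil and their
      difference.\<close>
    define S where "S m = (\<Sum>n=-int (N m)..int (N m). scaled \<alpha> (h m) (exact_coeff \<alpha>) n)" for m
    define T where "T m = (\<Sum>n=-int (N m)..int (N m). scaled \<alpha> (h m) (fft_coeff \<alpha> (N m)) n)" for m
    define R where "R m = (\<Sum>n=-int (N m)..int (N m). scaled \<alpha> (h m) (coeff_error \<alpha> (N m)) n)" for m
    have R: "c \<le> R m" "R m \<le> C" for m
      unfolding R_def by (rule lower upper; rule Nh)+
    have RST: "R m = S m - T m" for m
      unfolding R_def S_def T_def by (simp add: sum_subtractf[symmetric] scaled_diff coeff_error_def[abs_def])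
    have S: "S m > 0" and T: "T m < 0" for m
      unfolding S_def T_def sum_scaled
      using sum_exact_coeff_pos[OF alpha] sum_fft_coeff_neg[OF alpha Nh(1)] Nh(2)[of m]
      by (auto intro!: mult_pos_pos mult_pos_neg)
    \<comment> \<open>\<open>S m\<close> is \<open>R m + T m\<close> with \<open>T m\<close>
      negative, so the upper bound of the error carries over.\<close>
    have SC: "S m \<le> C" for m using R[of m] T[of m] unfolding RST by linarith
    have dft_R: "norm (dft (N m) (scaled \<alpha> (h m) (coeff_error \<alpha> (N m))) 0) = R m" for m
      unfolding dft_0 R_def[symmetric] using R(1)[of m] c by simp
    show "(\<lambda>m. dft (N m) (scaled \<alpha> (h m) (\<lambda>n. coeff_error \<alpha> (N m) n)) 0) \<in> \<Theta>(\<lambda>_. 1) \<and>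
        \<not> (\<lambda>m. Max ((\<lambda>j. cmod (dft (N m) (scaled \<alpha> (h m) (exact_coeff \<alpha>)) j
                               - dft (N m) (scaled \<alpha> (h m) (fft_coeff \<alpha> (N m))) j))
                      ` {- int (N m)..int (N m)})) \<longlonglongrightarrow> 0 \<and>
        (\<forall>m. \<exists>u v.
           stencil_solution (N m) (scaled \<alpha> (h m) (exact_coeff \<alpha>)) (\<lambda>_. 1) u \<and>
           stencil_solution (N m) (scaled \<alpha> (h m) (fft_coeff \<alpha> (N m))) (\<lambda>_. 1) v) \<and>
        (\<forall>(\<delta> :: real) (f :: nat \<Rightarrow> int \<Rightarrow> real) (u :: nat \<Rightarrow> int \<Rightarrow> real) (v :: nat \<Rightarrow> int \<Rightarrow> real).
           0 < \<delta> \<longrightarrow>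
           (\<forall>m. \<delta> \<le> \<bar>grid_mean (N m) (f m)\<bar>) \<longrightarrow>
           (\<forall>m. stencil_solution (N m) (scaled \<alpha> (h m) (exact_coeff \<alpha>)) (f m) (u m)) \<longrightarrow>
           (\<forall>m. stencil_solution (N m) (scaled \<alpha> (h m) (fft_coeff \<alpha> (N m))) (f m) (v m)) \<longrightarrow>
           \<not> (\<lambda>m. Max ((\<lambda>i. \<bar>u m i - v m i\<bar>) ` {- int (N m)..int (N m)})) \<longlonglongrightarrow> 0)"
    proof (intro conjI allI impI)
      show "(\<lambda>m. dft (N m) (scaled \<alpha> (h m) (coeff_error \<alpha> (N m))) 0) \<in> \<Theta>(\<lambda>_. 1)"
        by (rule bigtheta_1_of_bounds[OF c]) (simp_all add: dft_R R)
    next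
      let ?F = "\<lambda>m j. cmod (dft (N m) (scaled \<alpha> (h m) (exact_coeff \<alpha>)) j
                               - dft (N m) (scaled \<alpha> (h m) (fft_coeff \<alpha> (N m))) j)"
      have "c \<le> Max (?F m ` {- int (N m)..int (N m)})" for m
      proof -
        \<comment> \<open>Frequency 0 alone keeps the maximum away from 0.\<close>
        have "c \<le> ?F m 0"
          using R(1)[of m] unfolding dft_diff scaled_diff coeff_error_def[symmetric] dft_R .
        also have "\<dots> \<le> Max (?F m ` {- int (N m)..int (N m)})" by (intro Max_ge) auto
        finally show ?thesis .
      qed
      then show "\<not> (\<lambda>m. Max (?F m ` {- int (N m)..int (N m)})) \<longlonglongrightarrow> 0"
        by (rule not_tendsto_0_of_lower_bound[OF c(1)])
    next
      fix m
      show "\<exists>u v. stencil_solution (N m) (scaled \<alpha> (h m) (exact_coeff \<alpha>)) (\<lambda>_. 1) u \<and>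
           stencil_solution (N m) (scaled \<alpha> (h m) (fft_coeff \<alpha> (N m))) (\<lambda>_. 1) v"
        using stencil_solution_const[OF less_imp_neq[OF S[of m, unfolded S_def], symmetric]]
          stencil_solution_const[OF less_imp_neq[OF T[of m, unfolded T_def]]] by blast
    next
      fix \<delta> :: real and f u v :: "nat \<Rightarrow> int \<Rightarrow> real"
      assume \<delta>: "0 < \<delta>" "\<forall>m. \<delta> \<le> \<bar>grid_mean (N m) (f m)\<bar>"
        and u: "\<forall>m. stencil_solution (N m) (scaled \<alpha> (h m) (exact_coeff \<alpha>)) (f m) (u m)"
        and v: "\<forall>m. stencil_solution (N m) (scaled \<alpha> (h m) (fft_coeff \<alpha> (N m))) (f m) (v m)"
      have "\<delta> / C \<le> Max ((\<lambda>i. \<bar>u m i - v m i\<bar>) ` {- int (N m)..int (N m)})" for m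
        using S SC T \<delta>(1) \<delta>(2)[rule_format] u[rule_format] S_def[symmetric] v[rule_format] T_def[symmetric]
        by (rule solutions_differ)
      then show "\<not> (\<lambda>m. Max ((\<lambda>i. \<bar>u m i - v m i\<bar>) ` {- int (N m)..int (N m)})) \<longlonglongrightarrow> 0"
        by (rule not_tendsto_0_of_lower_bound[rotated]) (use \<delta> c in simp)
    qed
  qed
qed

end
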